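(* Let $d\ge 2$, $\lambda\in(0,d)$ and $R_0>0$. Suppose that $\widehat u=\{\widehat u(n)\}_{n\in\mathbf Z^d}$ is a complex-valued sequence satisfying $$(-\Delta_{disc}-\lambda)\widehat u(n)=0\quad\text{for all } n\in\mathbf Z^d \text{ with } |n|>R_0,$$ and $$\lim_{R\to\infty}\frac1R\sum_{R_0<|n|<R}|\widehat u(n)|^2=0.$$ Then there exists $R_1>R_0$ such that $\widehat u(n)=0$ for all $n\in\mathbf Z^d$ with $|n|>R_1$.
   Context: $\mathbf Z^d$ is the square lattice with standard basis $e_1,\dots,e_d$, and $|n|=(\sum_{i=1}^d n_i^2)^{1/2}$ for $n\in\mathbf Z^d$. The discrete Laplacian is $$(\Delta_{disc}\widehat u)(n)=\frac14\sum_{j=1}^d\big(\widehat u(n+e_j)+\widehat u(n-e_j)\big)-\frac d2\,\widehat u(n).$$ *)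

theory Defs
  imports "HOL-Analysis.Analysis"
begin

text \<open>The lattice \<open>\<int>\<^sup>d\<close> is the type \<open>int ^ 'd\<close> with \<open>d = CARD('d)\<close>; the standard basis
  vector \<open>e\<^sub>j\<close> is \<open>axis j 1\<close>.\<close>

text \<open>The library's norm on \<open>'a ^ 'd\<close> is not available for integer components.\<close>

definition lattice_norm :: "int ^ 'd \<Rightarrow> real"
  where "lattice_norm n = sqrt (\<Sum>i\<in>UNIV. (real_of_int (n $ i))\<^sup>2)"

definition disc_laplacian :: "(int ^ 'd \<Rightarrow> complex) \<Rightarrow> int ^ 'd \<Rightarrow> complex"
  where "disc_laplacian u n =
    1 / 4 * (\<Sum>j\<in>UNIV. u (n + axis j 1) + u (n - axis j 1)) - of_nat CARD('d) / 2 * u n"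

text \<open>Balls in the lattice are finite, so sums over bounded regions are genuine finite sums.\<close>

lemma finite_lattice_ball: "finite {n :: int ^ 'd. lattice_norm n < R}"
proof -
  let ?B = "{- \<lceil>R\<rceil>..\<lceil>R\<rceil>}"
  have "n $ i \<in> ?B" if n: "lattice_norm n < R" for n :: "int ^ 'd" and i
  proof -
    have "(real_of_int (n $ i))\<^sup>2 \<le> (\<Sum>i\<in>UNIV. (real_of_int (n $ i))\<^sup>2)"
      by (intro member_le_sum) auto
    then have "\<bar>real_of_int (n $ i)\<bar> \<le> lattice_norm n"
      unfolding lattice_norm_def by (metis real_sqrt_abs real_sqrt_le_mono)
    with n show ?thesis
      by simp linarith
  qed
  then have "{n :: int ^ 'd. lattice_norm n < R} \<subseteq> vec_lambda ` (UNIV \<rightarrow>\<^sub>E ?B)"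
    by (auto simp: image_iff intro!: bexI[where x = "vec_nth _"])
  then show ?thesis
    by (rule finite_subset) (simp add: finite_PiE)
qed

end

theory Submission
  imports Defs
    "HOL-Probability.Infinite_Product_Measure"
    "HOL-Complex_Analysis.Conformal_Mappings"
    "HOL-Real_Asymp.Real_Asymp"
begin

text \<open>Put \<open>\<mu> = 2 * d - 4 * \<lambda>\<close>, let \<open>L u n\<close> be the sum of \<open>u\<close> over the neighbours of \<open>n\<close> minus \<open>\<mu> * u n\<close>,
  and \<open>f = L u\<close>, which has finite support. The decay of \<open>u\<close> makes the boundary terms in Green's identity
  vanish against every \<open>\<psi>\<close> whose energy in balls of radius \<open>R\<close> is \<open>O(R)\<close>. Such \<open>\<psi>\<close> arise by Fourier
  synthesis in all coordinates except the \<open>i\<close>-th from coefficients that are bounded uniformly in the \<open>i\<close>-th coordinate.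

  For a frequency \<open>x\<close> the equation \<open>L \<psi> = 0\<close> reads \<open>b (k + 1) + b (k - 1) = D x * b k\<close>, with solutions \<open>r ^ k\<close>,
  \<open>r + 1 / r = D x\<close>. Where \<open>\<bar>D x\<bar> \<le> 2\<close> these are bounded, and testing \<open>f\<close> against them shows that the Laurent
  polynomial \<open>F x z\<close> formed from \<open>f\<close> vanishes at \<open>z = r\<close> and \<open>z = 1 / r\<close>. Its symmetric combinations
  \<open>z ^ m * F x z + z ^ (- m) * F x (1 / z)\<close> are polynomials in \<open>D x\<close> and so analytic in \<open>x\<close>; vanishing on
  an open set, they vanish everywhere, and \<open>(r - 1 / r) * F x r = 0\<close> for all \<open>x\<close>.

  Finally test \<open>f\<close> against a bounded second difference of the fundamental solution \<open>r ^ \<bar>k\<bar> / (r - 1 / r)\<close>: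
  far from the support of \<open>f\<close> this gives \<open>u (n + 2 e\<^sub>i) - 2 u n + u (n - 2 e\<^sub>i) = 0\<close>. So \<open>u\<close> is affine along
  rays in direction \<open>e\<^sub>i\<close>, and its decay forces it to vanish there.\<close>

subsection \<open>Green's identity on the lattice\<close>

lemma lattice_norm_eq_norm:
  "lattice_norm n = norm (\<chi> i. real_of_int (n $ i))" for n :: "int ^ 'd"
  by (simp add: lattice_norm_def norm_vec_def L2_set_def)

lemma lattice_norm_nonneg: "0 \<le> lattice_norm n"
  by (simp add: lattice_norm_eq_norm)

lemma lattice_norm_add: "lattice_norm (m + n) \<le> lattice_norm m + lattice_norm n"
  for m n :: "int ^ 'd"
proof -
  have "(\<chi> i. real_of_int ((m + n) $ i)) = (\<chi> i. real_of_int (m $ i)) + (\<chi> i. real_of_int (n $ i))"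
    by (simp add: vec_eq_iff)
  then show ?thesis
    unfolding lattice_norm_eq_norm by (metis norm_triangle_ineq)
qed

lemma lattice_norm_minus [simp]: "lattice_norm (- n) = lattice_norm n"
  by (simp add: lattice_norm_def)

lemma lattice_norm_axis [simp]: "lattice_norm (axis j s) = \<bar>real_of_int s\<bar>"
proof -
  have "(\<Sum>i\<in>UNIV. (real_of_int (axis j s $ i))\<^sup>2) = (\<Sum>i\<in>UNIV. if i = j then (real_of_int s)\<^sup>2 else 0)"
    by (intro sum.cong) (auto simp: axis_def)
  then show ?thesis
    by (simp add: lattice_norm_def)
qed

lemma abs_nth_le_lattice_norm: "\<bar>real_of_int (n $ i)\<bar> \<le> lattice_norm n"
  unfolding lattice_norm_eq_norm using component_le_norm_cart[of "\<chi> i. real_of_int (n $ i)" i] by simp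

lemma lattice_norm_le_sum: "lattice_norm n \<le> (\<Sum>i\<in>UNIV. \<bar>real_of_int (n $ i)\<bar>)"
  unfolding lattice_norm_eq_norm using norm_le_l1_cart[of "\<chi> i. real_of_int (n $ i)"] by simp

section \<open>Energies in balls, cutoffs and summation by parts\<close>

definition ball_energy :: "(int ^ 'd \<Rightarrow> complex) \<Rightarrow> real \<Rightarrow> real"
  where "ball_energy u R = (\<Sum>n | lattice_norm n < R. (cmod (u n))\<^sup>2)"

definition lattice_op :: "complex \<Rightarrow> (int ^ 'd \<Rightarrow> complex) \<Rightarrow> int ^ 'd \<Rightarrow> complex"
  where "lattice_op \<mu> u n = (\<Sum>j\<in>UNIV. u (n + axis j 1) + u (n - axis j 1)) - \<mu> * u n"

text \<open>A tent rather than an indicator: a unit step changes it by at most \<open>1 / R\<close>,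
  and this factor balances the growth of the energies in Green's identity.\<close>

definition cutoff :: "real \<Rightarrow> int ^ 'd \<Rightarrow> real"
  where "cutoff R n = max 0 (1 - lattice_norm n / R)"

lemma cutoff_eq_0: "R > 0 \<Longrightarrow> lattice_norm n \<ge> R \<Longrightarrow> cutoff R n = 0"
  by (simp add: cutoff_def field_simps)

lemma cutoff_tendsto: "((\<lambda>R. cutoff R n) \<longlongrightarrow> 1) at_top"
proof -
  have "((\<lambda>R. lattice_norm n / R) \<longlongrightarrow> 0) at_top"
    by real_asymp
  then have "((\<lambda>R. max 0 (1 - lattice_norm n / R)) \<longlongrightarrow> max 0 (1 - 0)) at_top"
    by (intro tendsto_intros)
  then show ?thesis
    by (simp add: cutoff_def)
qed

lemma cutoff_diff_le:
  fixes n e :: "int ^ 'd"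
  assumes "R > 0"
  shows "\<bar>cutoff R (n - e) - cutoff R n\<bar> \<le> lattice_norm e / R"
proof -
  have "\<bar>max 0 (1 - a) - max 0 (1 - b)\<bar> \<le> \<bar>a - b\<bar>" for a b :: real
    by auto
  then have "\<bar>cutoff R (n - e) - cutoff R n\<bar> \<le> \<bar>lattice_norm (n - e) / R - lattice_norm n / R\<bar>"
    unfolding cutoff_def .
  also have "\<dots> = \<bar>lattice_norm (n - e) - lattice_norm n\<bar> / R"
    using assms by (simp flip: diff_divide_distrib)
  also have "\<bar>lattice_norm (n - e) - lattice_norm n\<bar> \<le> lattice_norm e"
    using lattice_norm_add[of n "-e"] lattice_norm_add[of "n - e" e] by simp
  finally show ?thesis
    using assms by (simp add: divide_right_mono)
qed

lemma sum_shift_support: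
  fixes F :: "int ^ 'd \<Rightarrow> 'a::comm_monoid_add"
  assumes "finite A" "finite B" "\<And>n. F n \<noteq> 0 \<Longrightarrow> n \<in> A" "\<And>n. F n \<noteq> 0 \<Longrightarrow> n + e \<in> B"
  shows "(\<Sum>n\<in>A. F n) = (\<Sum>n\<in>B. F (n - e))"
  by (rule sum.reindex_bij_witness_not_neutral[where S' = "{n \<in> A. F n = 0}" and T' = "{n \<in> B. F (n - e) = 0}"
        and i = "\<lambda>n. n - e" and j = "\<lambda>n. n + e"])
     (use assms in auto)

lemma ball_energy_shift_le:
  fixes e :: "int ^ 'd"
  assumes "lattice_norm e \<le> r"
  shows "(\<Sum>n | lattice_norm n < R. (cmod (u (n + e)))\<^sup>2) \<le> ball_energy u (R + r)"
proof -
  have "(\<Sum>n | lattice_norm n < R. (cmod (u (n + e)))\<^sup>2) = (\<Sum>n\<in>(\<lambda>n. n + e) ` {n. lattice_norm n < R}. (cmod (u n))\<^sup>2)"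
    by (subst sum.reindex) (auto simp: inj_on_def)
  also have "\<dots> \<le> ball_energy u (R + r)"
    unfolding ball_energy_def
  proof (intro sum_mono2 finite_lattice_ball image_subsetI CollectI)
    fix n :: "int ^ 'd" assume "n \<in> {n. lattice_norm n < R}"
    then show "lattice_norm (n + e) < R + r"
      using lattice_norm_add[of n e] assms by simp
  qed auto
  finally show ?thesis .
qed

text \<open>Translating by \<open>e\<close> moves the difference onto the cutoff, whose increments
  are at most \<open>1 / R\<close>; the Cauchy-Schwarz inequality does the rest. If the energy of
  \<open>u\<close> is o(R), the bound tends to 0.\<close>

lemma commutator_le:
  fixes u \<psi> :: "int ^ 'd \<Rightarrow> complex" and e :: "int ^ 'd"
  assumes R: "R > 0" and e: "lattice_norm e = 1" and K: "ball_energy \<psi> (R + 2) \<le> K * (R + 2)"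
  shows "cmod (\<Sum>n | lattice_norm n < R + 1. cutoff R n * (u (n + e) * \<psi> n - u n * \<psi> (n - e)))
           \<le> sqrt (ball_energy u (R + 1) * (K * (R + 2))) / R"
proof -
  let ?B = "{n :: int ^ 'd. lattice_norm n < R + 1}"
  have fin: "finite ?B"
    by (rule finite_lattice_ball)
  have "(\<Sum>n\<in>?B. cutoff R n * (u (n + e) * \<psi> n)) = (\<Sum>n\<in>?B. cutoff R (n - e) * (u (n - e + e) * \<psi> (n - e)))"
  proof (rule sum_shift_support[OF fin fin])
    fix n assume "cutoff R n * (u (n + e) * \<psi> n) \<noteq> 0"
    then have *: "lattice_norm n < R"
      using cutoff_eq_0[OF R, of n] by force
    then show "n \<in> ?B" by simp
    show "n + e \<in> ?B"
      using * lattice_norm_add[of n e] e by simp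
  qed
  then have "(\<Sum>n\<in>?B. cutoff R n * (u (n + e) * \<psi> n - u n * \<psi> (n - e)))
      = (\<Sum>n\<in>?B. (cutoff R (n - e) - cutoff R n) * (u n * \<psi> (n - e)))"
    by (simp add: algebra_simps sum_subtractf)
  also have "cmod \<dots> \<le> (\<Sum>n\<in>?B. 1 / R * (cmod (u n) * cmod (\<psi> (n - e))))"
  proof (rule sum_norm_le)
    fix n
    have "\<bar>cutoff R (n - e) - cutoff R n\<bar> \<le> 1 / R"
      using cutoff_diff_le[OF R, of n e] e by simp
    then show "cmod ((cutoff R (n - e) - cutoff R n) * (u n * \<psi> (n - e))) \<le> 1 / R * (cmod (u n) * cmod (\<psi> (n - e)))"
      unfolding norm_mult of_real_diff[symmetric] norm_of_real by (intro mult_right_mono) auto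
  qed
  also have "\<dots> = 1 / R * (\<Sum>n\<in>?B. cmod (u n) * cmod (\<psi> (n - e)))"
    by (rule sum_distrib_left[symmetric])
  also have "(\<Sum>n\<in>?B. cmod (u n) * cmod (\<psi> (n - e))) \<le> sqrt (ball_energy u (R + 1) * (K * (R + 2)))"
  proof (rule real_le_rsqrt)
    have "(\<Sum>n\<in>?B. cmod (u n) * cmod (\<psi> (n - e)))\<^sup>2
        \<le> (\<Sum>n\<in>?B. (cmod (u n))\<^sup>2) * (\<Sum>n\<in>?B. (cmod (\<psi> (n - e)))\<^sup>2)"
      by (rule Cauchy_Schwarz_ineq_sum)
    also have "\<dots> \<le> ball_energy u (R + 1) * (K * (R + 2))"
    proof (rule mult_mono)
      have "(\<Sum>n\<in>?B. (cmod (\<psi> (n - e)))\<^sup>2) \<le> ball_energy \<psi> (R + 2)"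
        using ball_energy_shift_le[of "-e" 1 \<psi> "R + 1"] e by (simp add: add.assoc)
      then show "(\<Sum>n\<in>?B. (cmod (\<psi> (n - e)))\<^sup>2) \<le> K * (R + 2)"
        using K by simp
    qed (auto simp: ball_energy_def intro!: sum_nonneg)
    finally show "(\<Sum>n\<in>?B. cmod (u n) * cmod (\<psi> (n - e)))\<^sup>2 \<le> ball_energy u (R + 1) * (K * (R + 2))" .
  qed
  finally show ?thesis
    using R by (simp add: divide_right_mono)
qed

text \<open>Weighted by the cutoff, the difference of the two sides is a sum of commutators over all
  unit steps, which tends to 0. Its summand is supported in \<open>A \<union> B\<close>, a finite
  set on which the cutoff tends to 1.\<close>

lemma green_identity:
  fixes u \<psi> :: "int ^ 'd \<Rightarrow> complex"
  assumes u: "((\<lambda>R. ball_energy u R / R) \<longlongrightarrow> 0) at_top"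
    and \<psi>: "\<And>R. R \<ge> 1 \<Longrightarrow> ball_energy \<psi> R \<le> K * R"
    and A: "finite A" "\<And>n. n \<notin> A \<Longrightarrow> lattice_op \<mu> u n = 0"
    and B: "finite B" "\<And>n. n \<notin> B \<Longrightarrow> lattice_op \<mu> \<psi> n = 0"
  shows "(\<Sum>n\<in>A. lattice_op \<mu> u n * \<psi> n) = (\<Sum>n\<in>B. u n * lattice_op \<mu> \<psi> n)"
proof -
  define X where "X R e = (\<Sum>n | lattice_norm n < R + 1. cutoff R n * (u (n + e) * \<psi> n - u n * \<psi> (n - e)))"
    for R and e :: "int ^ 'd"
  define g where "g n = lattice_op \<mu> u n * \<psi> n - u n * lattice_op \<mu> \<psi> n" for n
  have X_lim: "((\<lambda>R. X R e) \<longlongrightarrow> 0) at_top" if e: "lattice_norm e = 1" for e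
  proof (rule Lim_null_comparison)
    show "\<forall>\<^sub>F R in at_top. norm (X R e) \<le> sqrt (ball_energy u (R + 1) * (K * (R + 2))) / R"
      using eventually_gt_at_top[of 0]
    proof eventually_elim
      case (elim R)
      then show ?case
        unfolding X_def by (intro commutator_le e \<psi>) auto
    qed
    have "((\<lambda>R. ball_energy u (R + 1) / (R + 1)) \<longlongrightarrow> 0) at_top"
      by (rule filterlim_compose[OF u]) real_asymp
    moreover have "((\<lambda>R. (R + 1) * (R + 2) / R\<^sup>2 :: real) \<longlongrightarrow> 1) at_top"
      by real_asymp
    \<comment> \<open>Under the root, the energy quotient is separated from a rational function of
      \<open>R\<close> with limit 1.\<close>
    ultimately have "((\<lambda>R. sqrt (ball_energy u (R + 1) / (R + 1) * (K * ((R + 1) * (R + 2) / R\<^sup>2)))) \<longlongrightarrow> sqrt (0 * (K * 1))) at_top"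
      by (intro tendsto_intros)
    then have "((\<lambda>R. sqrt (ball_energy u (R + 1) / (R + 1) * (K * ((R + 1) * (R + 2) / R\<^sup>2)))) \<longlongrightarrow> 0) at_top"
      by simp
    then show "((\<lambda>R. sqrt (ball_energy u (R + 1) * (K * (R + 2))) / R) \<longlongrightarrow> 0) at_top"
    proof (rule Lim_transform_eventually)
      show "\<forall>\<^sub>F R in at_top. sqrt (ball_energy u (R + 1) / (R + 1) * (K * ((R + 1) * (R + 2) / R\<^sup>2)))
            = sqrt (ball_energy u (R + 1) * (K * (R + 2))) / R"
        using eventually_gt_at_top[of 0]
      proof eventually_elim
        case (elim R)
        then have "ball_energy u (R + 1) / (R + 1) * (K * ((R + 1) * (R + 2) / R\<^sup>2))
            = ball_energy u (R + 1) * (K * (R + 2)) / R\<^sup>2"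
          by simp
        then show ?case
          using elim by (simp add: real_sqrt_divide)
      qed
    qed
  qed
  have "((\<lambda>R. \<Sum>j\<in>UNIV. X R (axis j 1) + X R (- axis j 1)) \<longlongrightarrow> (\<Sum>j\<in>(UNIV :: 'd set). 0 + 0)) at_top"
    by (intro tendsto_sum tendsto_add X_lim) auto
  moreover have "\<forall>\<^sub>F R in at_top. (\<Sum>j\<in>UNIV. X R (axis j 1) + X R (- axis j 1)) = (\<Sum>n\<in>A \<union> B. cutoff R n * g n)"
    using eventually_gt_at_top[of 0]
  proof eventually_elim
    case (elim R)
    let ?B = "{n :: int ^ 'd. lattice_norm n < R + 1}"
    \<comment> \<open>Opposite directions are paired: together they give the neighbour sums of
      \<open>u\<close> and \<open>\<psi>\<close>, while the terms with \<open>\<mu>\<close> cancel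
      in \<open>g\<close>.\<close>
    have "(\<Sum>j\<in>UNIV. X R (axis j 1) + X R (- axis j 1)) = (\<Sum>n\<in>?B. \<Sum>j\<in>UNIV.
        cutoff R n * (u (n + axis j 1) * \<psi> n - u n * \<psi> (n - axis j 1)) +
        cutoff R n * (u (n - axis j 1) * \<psi> n - u n * \<psi> (n + axis j 1)))"
      unfolding X_def by (subst sum.swap) (simp add: sum.distrib)
    also have "\<dots> = (\<Sum>n\<in>?B. cutoff R n * g n)"
      unfolding g_def lattice_op_def
      by (intro sum.cong refl)
         (simp add: algebra_simps sum.distrib sum_subtractf sum_distrib_left sum_distrib_right)
    \<comment> \<open>The cutoff vanishes outside the ball, which allows enlarging the index set;
      \<open>g\<close> vanishes outside \<open>A \<union> B\<close>, which allows shrinking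
      it.\<close>
    also have "\<dots> = (\<Sum>n\<in>?B \<union> (A \<union> B). cutoff R n * g n)"
      using elim A(1) B(1) finite_lattice_ball[of "R + 1"]
      by (intro sum.mono_neutral_left) (auto simp: cutoff_eq_0)
    also have "\<dots> = (\<Sum>n\<in>A \<union> B. cutoff R n * g n)"
      using A B finite_lattice_ball[of "R + 1"]
      by (intro sum.mono_neutral_right) (auto simp: g_def)
    finally show ?case .
  qed
  ultimately have "((\<lambda>R. \<Sum>n\<in>A \<union> B. cutoff R n * g n) \<longlongrightarrow> 0) at_top"
    by (simp add: tendsto_cong)
  moreover have "((\<lambda>R. \<Sum>n\<in>A \<union> B. cutoff R n * g n) \<longlongrightarrow> (\<Sum>n\<in>A \<union> B. of_real 1 * g n)) at_top"
    by (intro tendsto_intros cutoff_tendsto)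
  ultimately have "(\<Sum>n\<in>A \<union> B. g n) = 0"
    using tendsto_unique[OF trivial_limit_at_top_linorder] by force
  moreover have "(\<Sum>n\<in>A \<union> B. lattice_op \<mu> u n * \<psi> n) = (\<Sum>n\<in>A. lattice_op \<mu> u n * \<psi> n)"
    using A B by (intro sum.mono_neutral_right) auto
  moreover have "(\<Sum>n\<in>A \<union> B. u n * lattice_op \<mu> \<psi> n) = (\<Sum>n\<in>B. u n * lattice_op \<mu> \<psi> n)"
    using A B by (intro sum.mono_neutral_right) auto
  ultimately show ?thesis
    by (simp add: g_def sum_subtractf)
qed

subsection \<open>Partial Fourier synthesis\<close>

abbreviation angle_measure :: "real measure"
  where "angle_measure \<equiv> uniform_measure lborel {0..2 * pi}"

text \<open>All angles are kept, even that of the direction \<open>i\<close> singled out below: the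
  integrands do not depend on it, and having total mass 1 it integrates out. This avoids an index
  type with one coordinate removed.\<close>

abbreviation torus :: "('d \<Rightarrow> real) measure"
  where "torus \<equiv> Pi\<^sub>M UNIV (\<lambda>_. angle_measure)"

lemma prob_space_angle_measure: "prob_space angle_measure"
  by (rule prob_space_uniform_measure) auto

interpretation angle: prob_space angle_measure
  by (rule prob_space_angle_measure)

lemma product_sigma_finite_angle_measure: "product_sigma_finite (\<lambda>_. angle_measure)"
  by (simp add: product_sigma_finite_def angle.sigma_finite_measure_axioms)

lemma prob_space_torus: "prob_space (torus :: ('d :: finite \<Rightarrow> real) measure)"
  by (rule prob_space_PiM) (rule prob_space_angle_measure)

lemma cis_measurable [measurable]: "cis \<in> borel_measurable borel"
  by (intro borel_measurable_continuous_onI continuous_intros)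

lemma angle_integral_cis:
  fixes k :: int
  shows "(\<integral>t. cis (real_of_int k * t) \<partial>angle_measure) = (if k = 0 then 1 else 0)"
proof (cases "k = 0")
  case True
  then show ?thesis
    by (simp add: angle.prob_space)
next
  case False
  have eq: "angle_measure = density lborel (\<lambda>t. ennreal (indicator {0..2 * pi} t / (2 * pi)))"
    unfolding uniform_measure_def
  proof (intro density_cong AE_I2)
    have "indicator A t / ennreal c = ennreal (indicator A t / c)" if "c > 0" for c t :: real and A
      using that divide_ennreal[of 1 c] by (cases "t \<in> A") auto
    moreover have "emeasure lborel {0..2 * pi} = ennreal (2 * pi)"
      by (subst emeasure_lborel_Icc) simp_all
    ultimately show "indicator {0..2 * pi} t / emeasure lborel {0..2 * pi} = ennreal (indicator {0..2 * pi} t / (2 * pi))"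
      for t
      by (metis pi_gt_zero zero_less_mult_iff zero_less_numeral)
  qed measurable
  have "(\<integral>t. cis (real_of_int k * t) \<partial>angle_measure)
      = (\<integral>t. (indicator {0..2 * pi} t / (2 * pi)) *\<^sub>R cis (real_of_int k * t) \<partial>lborel)"
    unfolding eq by (subst integral_density) auto
  also have "\<dots> = (\<integral>t. indicator {0..2 * pi} t *\<^sub>R (cis (real_of_int k * t) /\<^sub>R (2 * pi)) \<partial>lborel)"
    by (intro Bochner_Integration.integral_cong refl) (simp only: divide_inverse scaleR_scaleR)
  also have "\<dots> = cis (real_of_int k * (2 * pi)) / (2 * pi * \<i> * k) - cis (real_of_int k * 0) / (2 * pi * \<i> * k)"
  proof (rule integral_FTC_atLeastAtMost)
    fix t :: real
    show "((\<lambda>t. cis (real_of_int k * t) / (2 * pi * \<i> * k)) has_vector_derivative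
            cis (real_of_int k * t) /\<^sub>R (2 * pi)) (at t within {0..2 * pi})"
      unfolding cis_conv_exp using False
      by (auto intro!: derivative_eq_intros has_vector_derivative_real_field simp: scaleR_conv_of_real field_simps)
  next
    show "continuous_on {0..2 * pi} (\<lambda>t. cis (real_of_int k * t) /\<^sub>R (2 * pi))"
      by (intro continuous_intros)
  qed auto
  also have "\<dots> = 0"
    by (simp add: cis_multiple_2pi mult.commute[of "real_of_int k"])
  finally show ?thesis
    using False by simp
qed

section \<open>Characters in the coordinates other than \<open>i\<close>, and their
  orthogonality\<close>

definition wave :: "'d \<Rightarrow> int ^ 'd \<Rightarrow> ('d \<Rightarrow> real) \<Rightarrow> complex"
  where "wave i n x = (\<Prod>j\<in>UNIV - {i}. cis (real_of_int (n $ j) * x j))"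

lemma wave_measurable [measurable]: "wave i n \<in> borel_measurable torus"
  unfolding wave_def by measurable

lemma norm_wave [simp]: "norm (wave i n x) = 1"
  by (simp add: wave_def prod_norm[symmetric])

lemma wave_add: "wave i (m + n) x = wave i m x * wave i n x"
  by (simp add: wave_def prod.distrib[symmetric] cis_mult ring_distribs)

lemma cnj_wave: "cnj (wave i n x) = wave i (- n) x"
  by (simp add: wave_def cis_cnj)

lemma wave_axis: "wave i (axis j s) x = (if j = i then 1 else cis (real_of_int s * x j))"
proof -
  have "wave i (axis j s) x = (\<Prod>l\<in>UNIV - {i}. if l = j then cis (real_of_int s * x j) else 1)"
    unfolding wave_def by (intro prod.cong) (auto simp: axis_def)
  also have "\<dots> = (if j = i then 1 else cis (real_of_int s * x j))"
    by (subst prod.delta) auto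
  finally show ?thesis .
qed

lemma integral_wave:
  "(\<integral>x. wave i n x \<partial>torus) = (if \<forall>j. j \<noteq> i \<longrightarrow> n $ j = 0 then 1 else 0)"
proof -
  \<comment> \<open>A factor with frequency 0 is inserted at \<open>i\<close>, so that the product
    runs over all coordinates and the integral factorises.\<close>
  have "(\<integral>x. wave i n x \<partial>torus)
      = (\<integral>x. (\<Prod>j\<in>UNIV. cis (real_of_int (if j = i then 0 else n $ j) * x j)) \<partial>torus)"
    unfolding wave_def by (intro Bochner_Integration.integral_cong refl prod.mono_neutral_cong_left) auto
  also have "\<dots> = (\<Prod>j\<in>UNIV. \<integral>t. cis (real_of_int (if j = i then 0 else n $ j) * t) \<partial>angle_measure)"
    by (rule product_sigma_finite.product_integral_prod[OF product_sigma_finite_angle_measure])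
       (auto intro!: angle.integrable_const_bound[where B = 1])
  also have "\<dots> = (if \<forall>j. j \<noteq> i \<longrightarrow> n $ j = 0 then 1 else 0)"
    by (auto simp: angle_integral_cis intro!: prod.neutral prod_zero)
  finally show ?thesis .
qed

lemma torus_integrable:
  assumes "f \<in> borel_measurable torus" "\<And>x. cmod (f x) \<le> K"
  shows "integrable (torus :: ('d::finite \<Rightarrow> real) measure) (f :: _ \<Rightarrow> complex)"
  using assms by (intro finite_measure.integrable_const_bound[where B = K] prob_space.finite_measure prob_space_torus) auto

definition synthesis :: "'d \<Rightarrow> (int \<Rightarrow> ('d \<Rightarrow> real) \<Rightarrow> complex) \<Rightarrow> int ^ 'd \<Rightarrow> complex"
  where "synthesis i b n = (\<integral>x. wave i n x * b (n $ i) x \<partial>torus)"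

text \<open>Bessel's inequality: among lattice points with the same \<open>i\<close>-th coordinate,
  distinct points have orthogonal waves.\<close>

lemma bessel_slice:
  fixes A :: "(int ^ 'd) set" and i :: 'd and b :: "('d \<Rightarrow> real) \<Rightarrow> complex"
  assumes A: "finite A" "\<And>n. n \<in> A \<Longrightarrow> n $ i = k"
    and b: "b \<in> borel_measurable torus" "\<And>x. cmod (b x) \<le> K"
  shows "(\<Sum>n\<in>A. (cmod (\<integral>x. wave i n x * b x \<partial>torus))\<^sup>2) \<le> K\<^sup>2"
proof -
  note [measurable] = b(1)
  interpret torus: prob_space "torus :: ('d \<Rightarrow> real) measure"
    by (rule prob_space_torus)
  define c where "c n = (\<integral>x. wave i n x * b x \<partial>torus)" for n
  define S where "S = (\<Sum>n\<in>A. (cmod (c n))\<^sup>2)"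
  \<comment> \<open>Chosen so that both the integral of \<open>g * b\<close> and the squared L2 norm
    of \<open>g\<close> equal \<open>S\<close>.\<close>
  define g where "g x = (\<Sum>n\<in>A. cnj (c n) * wave i n x)" for x
  have [measurable]: "g \<in> borel_measurable torus"
    unfolding g_def by measurable
  have K: "K \<ge> 0"
    using b(2) norm_ge_zero order_trans by blast
  have g_le: "cmod (g x) \<le> (\<Sum>n\<in>A. cmod (c n))" for x
    unfolding g_def by (rule sum_norm_le) (simp add: norm_mult)
  have int_wb: "integrable torus (\<lambda>x. wave i n x * b x)" for n
    by (rule torus_integrable[where K = K]) (auto simp: norm_mult b)
  have int_ww: "integrable torus (\<lambda>x. wave i n x)" for n :: "int ^ 'd"
    by (rule torus_integrable[where K = 1]) auto
  have int_gg: "integrable torus (\<lambda>x. (cmod (g x))\<^sup>2)"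
    by (rule torus.integrable_const_bound[where B = "(\<Sum>n\<in>A. cmod (c n))\<^sup>2"]) (auto intro!: power_mono g_le)
  have c: "a * c n = (\<integral>x. a * (wave i n x * b x) \<partial>torus)" for a n
    by (simp only: c_def integral_mult_right_zero)
  have "complex_of_real S = (\<Sum>n\<in>A. cnj (c n) * c n)"
    by (simp only: S_def of_real_sum complex_norm_square mult.commute)
  also have "\<dots> = (\<integral>x. (\<Sum>n\<in>A. cnj (c n) * (wave i n x * b x)) \<partial>torus)"
    unfolding c by (rule Bochner_Integration.integral_sum[symmetric]) (intro integrable_mult_right int_wb)
  also have "\<dots> = (\<integral>x. g x * b x \<partial>torus)"
    by (simp add: g_def sum_distrib_right mult.assoc)
  finally have S1: "complex_of_real S = (\<integral>x. g x * b x \<partial>torus)" .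
  have orth: "(\<integral>x. wave i (n - m) x \<partial>torus) = (if n = m then 1 else 0)" if "n \<in> A" "m \<in> A" for n m
  proof -
    have "n $ i = m $ i"
      using that A(2) by simp
    then have "(\<forall>j. j \<noteq> i \<longrightarrow> (n - m) $ j = 0) \<longleftrightarrow> n = m"
      by (simp add: vec_eq_iff) metis
    then show ?thesis
      by (simp add: integral_wave)
  qed
  have "(\<integral>x. complex_of_real ((cmod (g x))\<^sup>2) \<partial>torus)
      = (\<integral>x. (\<Sum>n\<in>A. \<Sum>m\<in>A. cnj (c n) * c m * wave i (n - m) x) \<partial>torus)"
    by (intro Bochner_Integration.integral_cong refl)
       (simp only: g_def complex_norm_square cnj_sum sum_product complex_cnj_mult complex_cnj_cnj cnj_wave
          diff_conv_add_uminus wave_add mult_ac, rule sum.swap)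
  also have "\<dots> = (\<Sum>n\<in>A. \<Sum>m\<in>A. cnj (c n) * c m * (\<integral>x. wave i (n - m) x \<partial>torus))"
    using int_ww by (simp add: Bochner_Integration.integral_sum)
  also have "\<dots> = (\<Sum>n\<in>A. \<Sum>m\<in>A. if n = m then cnj (c n) * c m else 0)"
    by (intro sum.cong refl) (simp add: orth)
  also have "\<dots> = complex_of_real S"
    unfolding S_def of_real_sum complex_norm_square using A(1) by (simp add: mult.commute)
  finally have S2: "(\<integral>x. (cmod (g x))\<^sup>2 \<partial>torus) = S"
    by (simp only: integral_complex_of_real of_real_eq_iff)
  have "S = cmod (\<integral>x. g x * b x \<partial>torus)"
    unfolding S1[symmetric] norm_of_real by (simp add: S_def sum_nonneg)
  \<comment> \<open>The arithmetic-geometric mean inequality leaves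
    \<open>S \<le> (K\<^sup>2 + S) / 2\<close>, which rearranges to the claim.\<close>
  also have "\<dots> \<le> (\<integral>x. (K\<^sup>2 + (cmod (g x))\<^sup>2) / 2 \<partial>torus)"
  proof (rule order_trans[OF integral_norm_bound integral_mono])
    show "integrable torus (\<lambda>x. cmod (g x * b x))"
      by (rule integrable_norm, rule torus_integrable[where K = "(\<Sum>n\<in>A. cmod (c n)) * K"])
         (auto simp: norm_mult intro!: mult_mono b g_le sum_nonneg)
    show "integrable torus (\<lambda>x. (K\<^sup>2 + (cmod (g x))\<^sup>2) / 2)"
      using int_gg by auto
    fix x :: "'d \<Rightarrow> real"
    have "cmod (g x) * cmod (b x) \<le> cmod (g x) * K"
      by (intro mult_left_mono b) auto
    also have "\<dots> \<le> (K\<^sup>2 + (cmod (g x))\<^sup>2) / 2"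
      using sum_squares_bound[of "cmod (g x)" K] by simp
    finally show "cmod (g x * b x) \<le> (K\<^sup>2 + (cmod (g x))\<^sup>2) / 2"
      by (simp add: norm_mult)
  qed
  also have "\<dots> = (K\<^sup>2 + S) / 2"
    using int_gg S2 by (simp add: torus.prob_space)
  finally show ?thesis
    by (simp add: S_def c_def)
qed

text \<open>The ball meets at most \<open>2 * \<lfloor>R\<rfloor> + 1 \<le> 3 * R\<close> slices of
  constant \<open>i\<close>-th coordinate, and Bessel's inequality bounds each by
  \<open>K\<^sup>2\<close>. This linear growth is what Green's identity asks of a test
  function.\<close>

lemma synthesis_energy:
  fixes i :: "'d :: finite" and b :: "int \<Rightarrow> ('d \<Rightarrow> real) \<Rightarrow> complex"
  assumes b: "\<And>k. b k \<in> borel_measurable torus" "\<And>k x. cmod (b k x) \<le> K" and R: "R \<ge> 1"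
  shows "ball_energy (synthesis i b) R \<le> 3 * K\<^sup>2 * R"
proof -
  let ?B = "{n :: int ^ 'd. lattice_norm n < R}"
  let ?I = "{-\<lfloor>R\<rfloor>..\<lfloor>R\<rfloor>}"
  have sub: "(\<lambda>n. n $ i) ` ?B \<subseteq> ?I"
  proof clarsimp
    fix n :: "int ^ 'd" assume "lattice_norm n < R"
    with abs_nth_le_lattice_norm[of n i] have "real_of_int \<bar>n $ i\<bar> \<le> R" by simp
    then have "\<bar>n $ i\<bar> \<le> \<lfloor>R\<rfloor>" by (simp only: le_floor_iff)
    then show "- \<lfloor>R\<rfloor> \<le> n $ i \<and> n $ i \<le> \<lfloor>R\<rfloor>" by linarith
  qed
  have "ball_energy (synthesis i b) R = (\<Sum>k\<in>?I. \<Sum>n | n \<in> ?B \<and> n $ i = k. (cmod (synthesis i b n))\<^sup>2)"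
    unfolding ball_energy_def using sub by (subst sum.group) (auto simp: finite_lattice_ball)
  also have "\<dots> \<le> (\<Sum>k\<in>?I. K\<^sup>2)"
  proof (rule sum_mono)
    fix k
    have "(\<Sum>n | n \<in> ?B \<and> n $ i = k. (cmod (synthesis i b n))\<^sup>2)
        = (\<Sum>n | n \<in> ?B \<and> n $ i = k. (cmod (\<integral>x. wave i n x * b k x \<partial>torus))\<^sup>2)"
      by (intro sum.cong) (auto simp: synthesis_def)
    also have "\<dots> \<le> K\<^sup>2"
      by (rule bessel_slice[where k = k]) (auto intro: b finite_subset[OF _ finite_lattice_ball[of R]])
    finally show "(\<Sum>n | n \<in> ?B \<and> n $ i = k. (cmod (synthesis i b n))\<^sup>2) \<le> K\<^sup>2" .
  qed
  also have "\<dots> = (2 * of_int \<lfloor>R\<rfloor> + 1) * K\<^sup>2"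
    using R by simp
  also have "\<dots> \<le> (3 * R) * K\<^sup>2"
    using R by (intro mult_right_mono) (linarith | simp)+
  finally show ?thesis by (simp add: mult_ac)
qed

text \<open>The \<open>D x\<close> of the overview. Neighbours in a direction \<open>j\<close> other
  than \<open>i\<close> contribute multiplication by \<open>2 * cos (x j)\<close>; these terms are
  moved to the side of \<open>\<mu>\<close>.\<close>

definition symbol :: "real \<Rightarrow> 'd \<Rightarrow> ('d \<Rightarrow> real) \<Rightarrow> real"
  where "symbol \<mu> i x = \<mu> - (\<Sum>j\<in>UNIV - {i}. 2 * cos (x j))"

lemma symbol_measurable [measurable]: "symbol \<mu> i \<in> borel_measurable torus"
  unfolding symbol_def by measurable

text \<open>A step along \<open>i\<close> shifts the index of \<open>b\<close>, while a step along
  another \<open>j\<close> multiplies the wave by \<open>cis (x j)\<close> or its conjugate. So the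
  lattice operator becomes a three-term recurrence for each frequency.\<close>

lemma lattice_op_synthesis:
  fixes i :: "'d :: finite" and b :: "int \<Rightarrow> ('d \<Rightarrow> real) \<Rightarrow> complex"
  assumes b: "\<And>k. b k \<in> borel_measurable torus" "\<And>k x. cmod (b k x) \<le> K"
  shows "lattice_op (of_real \<mu>) (synthesis i b) n
    = (\<integral>x. wave i n x * (b (n $ i + 1) x + b (n $ i - 1) x - symbol \<mu> i x * b (n $ i) x) \<partial>torus)"
proof -
  note [measurable] = b(1)
  have int: "integrable torus (\<lambda>x. wave i n x * b k x)" for n k
    by (rule torus_integrable[where K = K]) (auto simp: norm_mult b)
  \<comment> \<open>The joint contribution of the two neighbours in direction \<open>j\<close>, with
    the wave factored out.\<close>
  define c where "c j x = (if j = i then b (n $ i + 1) x + b (n $ i - 1) x else 2 * cos (x j) * b (n $ i) x)" for j x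
  have ax: "synthesis i b (n + axis j 1) + synthesis i b (n - axis j 1) = (\<integral>x. wave i n x * c j x \<partial>torus)"
    and int_c: "integrable torus (\<lambda>x. wave i n x * c j x)" for j
  proof -
    have *: "wave i n x * c j x = wave i (n + axis j 1) x * b ((n + axis j 1) $ i) x + wave i (n - axis j 1) x * b ((n - axis j 1) $ i) x"
      for x
    proof -
      have "c j x = (if j = i then b (n $ i + 1) x + b (n $ i - 1) x else (cis (x j) + cis (- x j)) * b (n $ i) x)"
        unfolding c_def by (auto simp: complex_eq_iff cos_of_real)
      moreover have "wave i (- axis j 1) x = (if j = i then 1 else cis (- x j))"
        by (simp add: cnj_wave[symmetric] wave_axis cis_cnj)
      moreover have "wave i (axis j 1) x = (if j = i then 1 else cis (x j))"
        by (simp add: wave_axis)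
      moreover have "axis j 1 $ i = (if j = i then 1 else 0 :: int)"
        by (simp add: axis_def)
      ultimately show ?thesis
        by (simp add: wave_add ring_distribs mult.assoc diff_conv_add_uminus del: add_uminus_conv_diff)
    qed
    show "integrable torus (\<lambda>x. wave i n x * c j x)"
      unfolding * by (intro Bochner_Integration.integrable_add int)
    show "synthesis i b (n + axis j 1) + synthesis i b (n - axis j 1) = (\<integral>x. wave i n x * c j x \<partial>torus)"
      unfolding * synthesis_def by (subst Bochner_Integration.integral_add) (auto intro: int)
  qed
  have "lattice_op (of_real \<mu>) (synthesis i b) n
      = (\<integral>x. (\<Sum>j\<in>UNIV. wave i n x * c j x) - \<mu> * (wave i n x * b (n $ i) x) \<partial>torus)"
    unfolding lattice_op_def ax using int_c int
    by (simp add: Bochner_Integration.integral_sum Bochner_Integration.integral_diff synthesis_def)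
  also have "\<dots> = (\<integral>x. wave i n x * (b (n $ i + 1) x + b (n $ i - 1) x - symbol \<mu> i x * b (n $ i) x) \<partial>torus)"
  proof (intro Bochner_Integration.integral_cong refl)
    fix x :: "'d \<Rightarrow> real"
    have "(\<Sum>j\<in>UNIV. c j x) = c i x + (\<Sum>j\<in>UNIV - {i}. c j x)"
      by (simp add: sum.remove)
    also have "(\<Sum>j\<in>UNIV - {i}. c j x) = (\<Sum>j\<in>UNIV - {i}. 2 * cos (x j) * b (n $ i) x)"
      by (intro sum.cong) (auto simp: c_def cos_of_real)
    finally have "(\<Sum>j\<in>UNIV. c j x) = b (n $ i + 1) x + b (n $ i - 1) x + (\<Sum>j\<in>UNIV - {i}. 2 * cos (x j)) * b (n $ i) x"
      by (simp add: c_def sum_distrib_right cos_of_real)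
    then show "(\<Sum>j\<in>UNIV. wave i n x * c j x) - \<mu> * (wave i n x * b (n $ i) x)
        = wave i n x * (b (n $ i + 1) x + b (n $ i - 1) x - symbol \<mu> i x * b (n $ i) x)"
      unfolding sum_distrib_left[symmetric] by (simp add: symbol_def algebra_simps flip: sum_distrib_left)
  qed
  finally show ?thesis .
qed

subsection \<open>The symbol of a finitely supported right-hand side\<close>

text \<open>An explicit, hence measurable, choice of a root of \<open>r + 1 / r = D\<close> in the
  closed unit disc. For \<open>\<bar>D\<bar> > 2\<close> the factor \<open>sgn D\<close> selects the
  real root of smaller modulus.\<close>

definition small_root :: "real \<Rightarrow> complex"
  where "small_root D = (if \<bar>D\<bar> \<le> 2 then Complex (D / 2) (sqrt (1 - D\<^sup>2 / 4))
    else of_real ((D - sgn D * sqrt (D\<^sup>2 - 4)) / 2))"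

lemma small_root_measurable [measurable]: "small_root \<in> borel_measurable borel"
  unfolding small_root_def Complex_eq by measurable

text \<open>Replaces the square roots by a number \<open>s\<close> known through its square;
  \<open>s * D \<ge> 0\<close> records the choice of sign.\<close>

lemma small_root_cases:
  obtains s where "\<bar>D\<bar> \<le> 2" "s\<^sup>2 = 1 - D\<^sup>2 / 4" "small_root D = Complex (D / 2) s"
  | s where "\<bar>D\<bar> > 2" "s\<^sup>2 = D\<^sup>2 - 4" "s * D \<ge> 0" "small_root D = of_real ((D - s) / 2)"
proof (cases "\<bar>D\<bar> \<le> 2")
  case True
  then have "D\<^sup>2 \<le> 4"
    using power_mono[of "\<bar>D\<bar>" 2 2] by simp
  then show ?thesis
    using True by (intro that(1)[of "sqrt (1 - D\<^sup>2 / 4)"]) (auto simp: small_root_def)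
next
  case False
  then have "D\<^sup>2 \<ge> 4"
    using power_mono[of 2 "\<bar>D\<bar>" 2] by simp
  then have "sqrt (D\<^sup>2 - 4) \<ge> 0" "(sqrt (D\<^sup>2 - 4))\<^sup>2 = D\<^sup>2 - 4"
    by auto
  then show ?thesis
    using False
    by (intro that(2)[of "sgn D * sqrt (D\<^sup>2 - 4)"])
       (auto simp: small_root_def power_mult_distrib sgn_if mult_nonneg_nonpos)
qed

lemma small_root_mult: "small_root D * (D - small_root D) = 1"
proof (cases D rule: small_root_cases)
  case (1 s)
  have "complex_of_real D - Complex (D / 2) s = Complex (D / 2) (- s)"
    by (simp add: complex_eq_iff)
  moreover have "D / 2 * (D / 2) + s * s = 1"
    using 1(2) by (simp add: power2_eq_square)
  ultimately show ?thesis
    unfolding 1(3) by (simp add: complex_eq_iff)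
next
  case (2 s)
  have "(D - s) / 2 * (D - (D - s) / 2) = (D\<^sup>2 - s\<^sup>2) / 4"
    by (simp add: field_simps power2_eq_square)
  then have "(D - s) / 2 * (D - (D - s) / 2) = 1"
    using 2(2) by simp
  then show ?thesis
    unfolding 2(4) of_real_diff[symmetric] of_real_mult[symmetric] by (simp only: of_real_1)
qed

lemma small_root_nonzero [simp]: "small_root D \<noteq> 0"
  using small_root_mult[of D] by auto

lemma small_root_add_inverse: "small_root D + inverse (small_root D) = of_real D"
  using inverse_unique[OF small_root_mult[of D]] by simp

lemma norm_small_root_eq_1:
  assumes "\<bar>D\<bar> \<le> 2"
  shows "cmod (small_root D) = 1"
proof (cases D rule: small_root_cases)
  case (1 s)
  then show ?thesis
    by (simp add: cmod_def power_divide)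
qed (use assms in auto)

text \<open>The two roots have product 1. Off the band the other root is \<open>(D + s) / 2\<close>
  with \<open>s\<close> not opposite in sign to \<open>D\<close>, so its modulus is at least
  1.\<close>

lemma norm_small_root_le_1: "cmod (small_root D) \<le> 1"
proof (cases D rule: small_root_cases)
  case (2 s)
  have "\<bar>D + s\<bar> \<ge> 2"
    using 2(1,3) by (auto simp: zero_le_mult_iff)
  moreover have "D - small_root D = of_real ((D + s) / 2)"
    unfolding 2(4) of_real_diff[symmetric] of_real_eq_iff by (simp add: field_simps)
  ultimately have *: "cmod (D - small_root D) \<ge> 1"
    by (simp only: norm_of_real abs_divide) simp
  have "cmod (small_root D) * cmod (D - small_root D) = 1"
    using small_root_mult[of D] by (metis norm_mult norm_one)
  then show ?thesis
    using mult_left_mono[OF *, of "cmod (small_root D)"] by simp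
qed (rule eq_refl[OF norm_small_root_eq_1])

section \<open>Vanishing of the Laurent polynomial at the roots on the unit circle\<close>

lemma cnj_measurable [measurable]: "cnj \<in> borel_measurable borel"
  by (intro borel_measurable_continuous_onI continuous_intros)

text \<open>The \<open>F x z\<close> of the overview: a Fourier transform of \<open>f\<close> in
  which \<open>z\<close> replaces the character of the \<open>i\<close>-th coordinate.\<close>

definition laurent :: "(int ^ 'd \<Rightarrow> complex) \<Rightarrow> (int ^ 'd) set \<Rightarrow> 'd \<Rightarrow> ('d \<Rightarrow> real) \<Rightarrow> complex \<Rightarrow> complex"
  where "laurent f A i x z = (\<Sum>n\<in>A. f n * wave i n x * z powi (n $ i))"

text \<open>Green's identity with a homogeneous solution built from powers of \<open>\<zeta>\<close>
  shows that \<open>F\<close> has zero L2 norm on the band. Keeping \<open>\<zeta>\<close> abstract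
  covers both \<open>small_root\<close> and its inverse.\<close>

lemma laurent_vanishes_AE:
  fixes u :: "int ^ 'd \<Rightarrow> complex" and \<zeta> :: "real \<Rightarrow> complex"
  assumes u: "((\<lambda>R. ball_energy u R / R) \<longlongrightarrow> 0) at_top"
    and A: "finite A" "\<And>n. n \<notin> A \<Longrightarrow> lattice_op (of_real \<mu>) u n = 0"
    and \<zeta>: "\<zeta> \<in> borel_measurable borel" "\<And>D. \<bar>D\<bar> \<le> 2 \<Longrightarrow> cmod (\<zeta> D) = 1"
      "\<And>D. \<bar>D\<bar> \<le> 2 \<Longrightarrow> \<zeta> D + inverse (\<zeta> D) = of_real D"
  shows "AE x in torus. \<bar>symbol \<mu> i x\<bar> \<le> 2 \<longrightarrow>
           laurent (lattice_op (of_real \<mu>) u) A i x (\<zeta> (symbol \<mu> i x)) = 0"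
proof -
  note [measurable] = \<zeta>(1)
  define f where "f = lattice_op (of_real \<mu>) u"
  define F where "F x = laurent f A i x (\<zeta> (symbol \<mu> i x))" for x
  define K where "K = (\<Sum>n\<in>A. cmod (f n))"
  \<comment> \<open>The factor \<open>cnj (F x)\<close> turns the pairing with \<open>f\<close> into
    the integral of the squared modulus of \<open>F\<close>. Truncation to the band keeps the powers
    bounded in \<open>k\<close>.\<close>
  define b where "b k x = (if \<bar>symbol \<mu> i x\<bar> \<le> 2 then \<zeta> (symbol \<mu> i x) powi k * cnj (F x) else 0)" for k x
  have [measurable]: "F \<in> borel_measurable torus"
    unfolding F_def laurent_def power_int_def by measurable
  have [measurable]: "b k \<in> borel_measurable torus" for k
    unfolding b_def power_int_def by measurable
  have F_le: "cmod (F x) \<le> K" if "\<bar>symbol \<mu> i x\<bar> \<le> 2" for x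
    unfolding F_def laurent_def K_def
    by (rule sum_norm_le) (simp add: norm_mult norm_power_int \<zeta>(2)[OF that])
  have b_le: "cmod (b k x) \<le> K" for k x
    using F_le[of x] by (auto simp: b_def norm_mult norm_power_int \<zeta>(2) K_def sum_nonneg)
  have rec: "b (k + 1) x + b (k - 1) x - symbol \<mu> i x * b k x = 0" for k x
  proof (cases "\<bar>symbol \<mu> i x\<bar> \<le> 2")
    case True
    let ?z = "\<zeta> (symbol \<mu> i x)"
    have "?z \<noteq> 0"
      using \<zeta>(2)[OF True] by auto
    then have "b (k + 1) x + b (k - 1) x = (?z + inverse ?z) * b k x"
      using True by (simp add: b_def power_int_add power_int_diff field_simps)
    then show ?thesis
      using \<zeta>(3)[OF True] by simp
  qed (simp add: b_def)
  \<comment> \<open>The empty set serves as \<open>B\<close>, because the test function solves the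
    homogeneous equation everywhere.\<close>
  have "(\<Sum>n\<in>A. f n * synthesis i b n) = (\<Sum>n\<in>{}. u n * lattice_op (of_real \<mu>) (synthesis i b) n)"
    unfolding f_def
  proof (rule green_identity[OF u _ A])
    show "ball_energy (synthesis i b) R \<le> 3 * K\<^sup>2 * R" if "R \<ge> 1" for R
      by (rule synthesis_energy) (use b_le that in auto)
    show "lattice_op (of_real \<mu>) (synthesis i b) n = 0" for n
      by (subst lattice_op_synthesis[where K = K]) (auto simp: b_le rec)
  qed auto
  also have "(\<Sum>n\<in>A. f n * synthesis i b n) = (\<integral>x. (\<Sum>n\<in>A. f n * (wave i n x * b (n $ i) x)) \<partial>torus)"
    unfolding synthesis_def integral_mult_right_zero[symmetric]
    by (rule Bochner_Integration.integral_sum[symmetric], intro integrable_mult_right torus_integrable[where K = K])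
       (auto simp: norm_mult b_le)
  also have "\<dots> = (\<integral>x. complex_of_real (if \<bar>symbol \<mu> i x\<bar> \<le> 2 then (cmod (F x))\<^sup>2 else 0) \<partial>torus)"
  proof (intro Bochner_Integration.integral_cong refl)
    fix x :: "'d \<Rightarrow> real"
    show "(\<Sum>n\<in>A. f n * (wave i n x * b (n $ i) x)) = complex_of_real (if \<bar>symbol \<mu> i x\<bar> \<le> 2 then (cmod (F x))\<^sup>2 else 0)"
    proof (cases "\<bar>symbol \<mu> i x\<bar> \<le> 2")
      case True
      have "(\<Sum>n\<in>A. f n * (wave i n x * b (n $ i) x)) = F x * cnj (F x)"
        using True unfolding b_def F_def[of x] laurent_def sum_distrib_right by (simp add: mult.assoc)
      then show ?thesis
        using True by (simp only: complex_norm_square if_True)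
    qed (simp add: b_def)
  qed
  finally have int0: "(\<integral>x. (if \<bar>symbol \<mu> i x\<bar> \<le> 2 then (cmod (F x))\<^sup>2 else 0) \<partial>torus) = 0"
    by (simp only: integral_complex_of_real of_real_eq_0_iff sum.empty)
  have "integrable torus (\<lambda>x. if \<bar>symbol \<mu> i x\<bar> \<le> 2 then (cmod (F x))\<^sup>2 else 0)"
    by (rule finite_measure.integrable_const_bound[OF prob_space.finite_measure[OF prob_space_torus], where B = "K\<^sup>2"])
       (auto intro!: power_mono F_le)
  then have "AE x in torus. (if \<bar>symbol \<mu> i x\<bar> \<le> 2 then (cmod (F x))\<^sup>2 else 0) = 0"
    using int0 by (subst (asm) integral_nonneg_eq_0_iff_AE) auto
  then show ?thesis
    by eventually_elim (simp add: F_def f_def split: if_splits)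
qed

section \<open>Symmetric combinations that are analytic in the frequency\<close>

fun dickson :: "nat \<Rightarrow> complex \<Rightarrow> complex" where
  "dickson 0 w = 2"
| "dickson (Suc 0) w = w"
| "dickson (Suc (Suc k)) w = w * dickson (Suc k) w - dickson k w"

text \<open>These are the Dickson polynomials of the first kind, that is
  \<open>2 * T_k (w / 2)\<close> with Chebyshev's \<open>T_k\<close>.\<close>

lemma dickson_add_inverse: "z \<noteq> 0 \<Longrightarrow> dickson k (z + inverse z) = z ^ k + inverse z ^ k"
  by (induction k "z + inverse z" rule: dickson.induct) (auto simp: field_simps)

lemma dickson_continuous [continuous_intros]:
  "continuous_on S g \<Longrightarrow> continuous_on S (\<lambda>x. dickson k (g x))"
  by (induction k w \<equiv> "0 :: complex" rule: dickson.induct) (auto intro!: continuous_intros)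

lemma dickson_holomorphic [holomorphic_intros]:
  "g holomorphic_on S \<Longrightarrow> (\<lambda>x. dickson k (g x)) holomorphic_on S"
  by (induction k w \<equiv> "0 :: complex" rule: dickson.induct) (auto intro!: holomorphic_intros)

text \<open>Invariance under exchanging \<open>z\<close> with \<open>1 / z\<close> lets this be
  written through \<open>symbol\<close> alone, so it stays analytic in \<open>x\<close> where the
  individual roots branch.\<close>

definition laurent_trace ::
  "(int ^ 'd \<Rightarrow> complex) \<Rightarrow> (int ^ 'd) set \<Rightarrow> real \<Rightarrow> 'd \<Rightarrow> int \<Rightarrow> ('d \<Rightarrow> real) \<Rightarrow> complex"
  where "laurent_trace f A \<mu> i m x =
    (\<Sum>n\<in>A. f n * wave i n x * dickson (nat \<bar>n $ i + m\<bar>) (symbol \<mu> i x))"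

lemma laurent_trace_eq:
  assumes "z \<noteq> 0" "z + inverse z = of_real (symbol \<mu> i x)"
  shows "laurent_trace f A \<mu> i m x = z powi m * laurent f A i x z + inverse z powi m * laurent f A i x (inverse z)"
proof -
  have "dickson (nat \<bar>k\<bar>) (symbol \<mu> i x) = z powi k + inverse z powi k" for k
    unfolding assms(2)[symmetric] dickson_add_inverse[OF assms(1)]
    by (cases "k \<ge> 0") (auto simp: power_int_def)
  then have "laurent_trace f A \<mu> i m x = (\<Sum>n\<in>A. f n * wave i n x * (z powi (n $ i + m) + inverse z powi (n $ i + m)))"
    by (simp add: laurent_trace_def)
  then show ?thesis
    using assms(1) by (simp add: laurent_def power_int_add algebra_simps sum_distrib_left sum.distrib)
qed

lemma continuous_on_coordinate [continuous_intros]: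
  "continuous_on S (\<lambda>x :: 'a \<Rightarrow> 'b :: topological_space. x j)"
  by (rule continuous_on_subset[OF continuous_on_product_coordinates]) simp

lemma symbol_continuous [continuous_intros]: "continuous_on S (symbol \<mu> (i :: 'd :: finite))"
  unfolding symbol_def
  by (intro continuous_intros)

lemma laurent_trace_continuous: "continuous_on S (laurent_trace f A \<mu> i m)"
  unfolding laurent_trace_def wave_def
  by (intro continuous_intros)

section \<open>From almost all frequencies in an open set to all frequencies\<close>

lemma emeasure_angle_measure_pos:
  assumes "open X" "t \<in> X" "0 < t" "t < 2 * pi"
  shows "emeasure angle_measure (X \<inter> {0<..<2 * pi}) > 0"
proof -
  have "open (X \<inter> {0<..<2 * pi})"
    using assms(1) by (intro open_Int) auto
  moreover have "t \<in> X \<inter> {0<..<2 * pi}"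
    using assms by auto
  ultimately obtain e where e: "e > 0" "{t - e<..<t + e} \<subseteq> X \<inter> {0<..<2 * pi}"
    by (metis open_contains_ball ball_eq_greaterThanLessThan)
  have X: "X \<in> sets borel"
    using assms(1) by auto
  have "0 < emeasure lborel {t - e<..<t + e}"
    using e(1) by simp
  also have "\<dots> \<le> emeasure lborel (X \<inter> {0<..<2 * pi})"
    using e(2) X by (intro emeasure_mono) auto
  also have "\<dots> = emeasure lborel ({0..2 * pi} \<inter> (X \<inter> {0<..<2 * pi}))"
    by (rule arg_cong[where f = "emeasure lborel"]) auto
  finally have "emeasure lborel ({0..2 * pi} \<inter> (X \<inter> {0<..<2 * pi})) \<noteq> 0"
    by auto
  moreover have "emeasure lborel {0..2 * pi} \<noteq> \<infinity>"
    by (subst emeasure_lborel_Icc) auto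
  ultimately have "emeasure lborel ({0..2 * pi} \<inter> (X \<inter> {0<..<2 * pi})) / emeasure lborel {0..2 * pi} \<noteq> 0"
    by (simp only: ennreal_divide_eq_0_iff infinity_ennreal_def) simp
  then show ?thesis
    using X by (subst emeasure_uniform_measure) (auto simp: zero_less_iff_neq_zero simp del: emeasure_uniform_measure)
qed

text \<open>If \<open>h x\<close> were nonzero, \<open>h\<close> would be nonzero on an open box
  around \<open>x\<close> inside \<open>W\<close>. Cut down to angles between 0 and
  \<open>2 * pi\<close>, that box still has positive measure.\<close>

lemma AE_torus_continuous_imp:
  fixes h :: "('d :: finite \<Rightarrow> real) \<Rightarrow> complex"
  assumes AE: "AE x in torus. x \<in> W \<longrightarrow> h x = 0" and W: "open W" and h: "continuous_on UNIV h"
    and x: "x \<in> W" "\<And>j. 0 < x j" "\<And>j. x j < 2 * pi"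
  shows "h x = 0"
proof (rule ccontr)
  assume "h x \<noteq> 0"
  have "open {x. h x \<noteq> 0}"
    using h by (intro open_Collect_neq) auto
  then have "openin (product_topology (\<lambda>i. euclidean) UNIV) (W \<inter> {x. h x \<noteq> 0})"
    using W by (metis open_Int open_fun_def)
  from product_topology_open_contains_basis[OF this, of x] obtain X where
    X: "x \<in> (\<Pi>\<^sub>E j\<in>UNIV. X j)" "\<And>j. open (X j)" "(\<Pi>\<^sub>E j\<in>UNIV. X j) \<subseteq> W \<inter> {x. h x \<noteq> 0}"
    using x(1) \<open>h x \<noteq> 0\<close> by auto
  define Y where "Y j = X j \<inter> {0<..<2 * pi}" for j
  have Y: "Y j \<in> sets borel" for j
    unfolding Y_def using X(2) by (intro sets.Int) auto
  have pos: "emeasure angle_measure (Y j) > 0" for j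
    unfolding Y_def using X(1,2) x by (intro emeasure_angle_measure_pos[of _ "x j"]) (auto simp: PiE_iff)
  have eq: "emeasure torus (\<Pi>\<^sub>E j\<in>UNIV. Y j) = (\<Prod>j\<in>UNIV. emeasure angle_measure (Y j))"
    by (rule product_sigma_finite.emeasure_PiM[OF product_sigma_finite_angle_measure]) (auto simp: Y)
  have nz: "(\<Prod>j\<in>J. emeasure angle_measure (Y j)) \<noteq> 0" if "finite J" for J
    using that by induction (use pos in \<open>auto simp del: emeasure_uniform_measure simp: zero_less_iff_neq_zero\<close>)
  obtain N where N: "{x \<in> space torus. \<not> (x \<in> W \<longrightarrow> h x = 0)} \<subseteq> N" "emeasure torus N = 0" "N \<in> sets torus"
    using AE by (rule AE_E)
  have "(\<Pi>\<^sub>E j\<in>UNIV. Y j) \<subseteq> (\<Pi>\<^sub>E j\<in>UNIV. X j)"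
    by (rule PiE_mono) (auto simp: Y_def)
  then have "(\<Pi>\<^sub>E j\<in>UNIV. Y j) \<subseteq> N"
    using X(3) N(1) by (simp add: space_PiM) blast
  then have "emeasure torus (\<Pi>\<^sub>E j\<in>UNIV. Y j) \<le> emeasure torus N"
    using N(3) by (rule emeasure_mono)
  then have "(\<Prod>j\<in>UNIV. emeasure angle_measure (Y j)) = 0"
    unfolding eq N(2) by (simp only: le_zero_eq)
  then show False
    using nz[OF finite] by contradiction
qed

text \<open>Restricted to the line from \<open>x0\<close> to \<open>x1\<close>, the trace extends to
  an entire function of one complex variable. It vanishes at real parameters near 0, hence also at
  1.\<close>

lemma laurent_trace_analytic_continuation:
  fixes x0 :: "'d :: finite \<Rightarrow> real"
  assumes V: "open V" "x0 \<in> V" and zero: "\<And>x. x \<in> V \<Longrightarrow> laurent_trace f A \<mu> i m x = 0"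
  shows "laurent_trace f A \<mu> i m x1 = 0"
proof -
  \<comment> \<open>The line with complex parameter; \<open>g\<close> is the entire extension and
    \<open>\<gamma>\<close> the same line with real parameter.\<close>
  define p where "p j t = complex_of_real (x0 j) + t * complex_of_real (x1 j - x0 j)" for j t
  define g where "g t = (\<Sum>n\<in>A. f n * (\<Prod>j\<in>UNIV - {i}. exp (\<i> * (of_int (n $ j) * p j t))) *
      dickson (nat \<bar>n $ i + m\<bar>) (of_real \<mu> - (\<Sum>j\<in>UNIV - {i}. 2 * cos (p j t))))" for t
  define \<gamma> where "\<gamma> t = (\<lambda>j. x0 j + t * (x1 j - x0 j))" for t
  have g: "g (of_real t) = laurent_trace f A \<mu> i m (\<gamma> t)" for t
  proof -
    have p: "p j (of_real t) = of_real (\<gamma> t j)" for j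
      by (simp add: p_def \<gamma>_def)
    have "exp (\<i> * (of_int k * of_real y)) = cis (real_of_int k * y)" for k y
      by (simp add: cis_conv_exp)
    then show ?thesis
      by (simp add: g_def laurent_trace_def wave_def symbol_def p cos_of_real)
  qed
  have "continuous_on UNIV \<gamma>"
    unfolding \<gamma>_def by (intro continuous_intros)
  then have "open (\<gamma> -` V)"
    using V(1) by (metis open_vimage)
  moreover have "0 \<in> \<gamma> -` V"
    using V(2) by (simp add: \<gamma>_def)
  ultimately obtain e where e: "e > 0" "ball 0 e \<subseteq> \<gamma> -` V"
    by (meson open_contains_ball)
  have "g 1 = 0"
  proof (rule analytic_continuation[where f = g and S = UNIV and \<xi> = 0])
    show "g holomorphic_on UNIV"
      unfolding g_def p_def by (intro holomorphic_intros)
    show "g z = 0" if z: "z \<in> of_real ` ball 0 e" for z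
    proof -
      obtain t where "z = of_real t" "t \<in> ball 0 e"
        using z by (rule imageE)
      then show ?thesis
        using e(2) zero[of "\<gamma> t"] by (auto simp: g)
    qed
    show "0 islimpt (complex_of_real ` ball 0 e)"
      unfolding islimpt_approachable
    proof (intro allI impI)
      fix d :: real assume "d > 0"
      then show "\<exists>z\<in>complex_of_real ` ball 0 e. z \<noteq> 0 \<and> dist z 0 < d"
        using e(1) by (intro bexI[of _ "of_real (min d e / 2)"] imageI) (auto simp: dist_norm)
    qed
  qed auto
  moreover have "\<gamma> 1 = x1"
    by (auto simp: \<gamma>_def)
  ultimately show ?thesis
    using g[of 1] by simp
qed

text \<open>The traces vanish on a nonempty open set and hence everywhere, which reaches frequencies
  whose roots leave the unit circle. Two traces suffice to isolate the value at \<open>z\<close>, up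
  to a factor that degenerates when the roots coincide.\<close>

lemma laurent_vanishes:
  fixes u :: "int ^ 'd \<Rightarrow> complex"
  assumes u: "((\<lambda>R. ball_energy u R / R) \<longlongrightarrow> 0) at_top"
    and A: "finite A" "\<And>n. n \<notin> A \<Longrightarrow> lattice_op (of_real \<mu>) u n = 0"
    and \<mu>: "\<bar>\<mu>\<bar> < 2 * real CARD('d)"
    and z: "z \<noteq> 0" "z + inverse z = of_real (symbol \<mu> i x)"
  shows "(z - inverse z) * laurent (lattice_op (of_real \<mu>) u) A i x z = 0"
proof -
  define f where "f = lattice_op (of_real \<mu>) u"
  define q where "q = \<mu> / (2 * real CARD('d))"
  \<comment> \<open>All cosines equal \<open>q\<close>, so the symbol is \<open>2 * q\<close>,
    strictly inside the band: this is where the bound on \<open>\<mu>\<close> enters.\<close>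
  define x0 :: "'d \<Rightarrow> real" where "x0 = (\<lambda>_. arccos q)"
  define V where "V = {x. \<bar>symbol \<mu> i x\<bar> < 2} \<inter> (\<Inter>j. {x. 0 < x j} \<inter> {x. x j < 2 * pi})"
  have q: "-1 < q" "q < 1" and \<mu>_eq: "\<mu> = 2 * real CARD('d) * q"
    using \<mu> by (auto simp: q_def field_simps abs_less_iff)
  have cos: "cos (x0 j) = q" for j
    using q by (simp add: x0_def)
  have "symbol \<mu> i x0 = 2 * real CARD('d) * q - 2 * (real CARD('d) - 1) * q"
    by (simp add: symbol_def cos \<mu>_eq of_nat_diff Suc_le_eq)
  also have "\<dots> = 2 * q"
    by (simp add: algebra_simps)
  finally have "\<bar>symbol \<mu> i x0\<bar> < 2"
    using q by simp
  moreover have "0 < x0 j" "x0 j < 2 * pi" for j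
    using arccos_lt_bounded[OF q] pi_gt_zero by (auto simp: x0_def)
  ultimately have "x0 \<in> V"
    by (simp add: V_def)
  have "open V"
    unfolding V_def
    by (intro open_Int open_INT open_Collect_less ballI finite continuous_intros)
  have trace: "laurent_trace f A \<mu> i m x = 0" for m x
  proof (rule laurent_trace_analytic_continuation[OF \<open>open V\<close> \<open>x0 \<in> V\<close>])
    fix y assume y: "y \<in> V"
    have "AE x in torus. \<bar>symbol \<mu> i x\<bar> \<le> 2 \<longrightarrow> laurent f A i x (small_root (symbol \<mu> i x)) = 0"
      unfolding f_def
      by (rule laurent_vanishes_AE[OF u A]) (auto simp: norm_small_root_eq_1 small_root_add_inverse)
    moreover have "AE x in torus. \<bar>symbol \<mu> i x\<bar> \<le> 2 \<longrightarrow> laurent f A i x (inverse (small_root (symbol \<mu> i x))) = 0"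
      unfolding f_def
      by (rule laurent_vanishes_AE[OF u A, where \<zeta> = "\<lambda>D. inverse (small_root D)"])
         (auto simp: norm_small_root_eq_1 norm_inverse add.commute small_root_add_inverse)
    ultimately have "AE x in torus. x \<in> V \<longrightarrow> laurent_trace f A \<mu> i m x = 0"
    proof eventually_elim
      case (elim x)
      then show ?case
        using laurent_trace_eq[OF small_root_nonzero small_root_add_inverse, where f = f and A = A and m = m]
        by (auto simp: V_def)
    qed
    then show "laurent_trace f A \<mu> i m y = 0"
      by (rule AE_torus_continuous_imp[OF _ \<open>open V\<close> laurent_trace_continuous y])
         (use y in \<open>auto simp: V_def\<close>)
  qed
  \<comment> \<open>The trace with \<open>m = 0\<close> says that \<open>F\<close> changes sign when
    \<open>z\<close> is inverted; inserting this in the trace with \<open>m = 1\<close> gives the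
    claim.\<close>
  have "laurent f A i x z + laurent f A i x (inverse z) = 0"
    using trace[of 0 x] unfolding laurent_trace_eq[OF z] by simp
  then have "laurent f A i x (inverse z) = - laurent f A i x z"
    by (simp add: eq_neg_iff_add_eq_0 add.commute)
  then show ?thesis
    using trace[of 1 x] unfolding laurent_trace_eq[OF z] f_def[symmetric] by (simp add: algebra_simps)
qed

subsection \<open>Second differences along an axis\<close>

text \<open>Taking second differences with step 2 of the fundamental solution \<open>r ^ \<bar>k\<bar> / (r - 1 / r)\<close> of
  \<open>a (k + 1) + a (k - 1) = (r + 1 / r) * a k\<close> removes its poles at \<open>r = 1\<close> and \<open>r = -1\<close>.\<close>

definition kernel :: "complex \<Rightarrow> nat \<Rightarrow> complex"
  where "kernel r k = (if k = 0 then 2 * r else if k = 1 then r\<^sup>2 else r ^ (k + 1) - r ^ (k - 1))"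

lemma kernel_Suc_Suc: "kernel r (Suc (Suc k)) = r ^ k * (r ^ 3 - r)"
  by (simp add: kernel_def power3_eq_cube algebra_simps)

text \<open>The recurrence is centred at \<open>Suc k\<close>, so \<open>k = 1\<close> on the right
  means a source at index 2.\<close>

lemma kernel_recurrence_nat:
  assumes "r \<noteq> 0"
  shows "kernel r (Suc (Suc k)) + kernel r k - (r + inverse r) * kernel r (Suc k) = (if k = 1 then 1 else 0)"
proof -
  obtain i where i: "inverse r = i" "r * i = 1"
    using assms by simp
  consider "k = 0" | "k = Suc 0" | m where "k = Suc (Suc m)"
    by (metis not0_implies_Suc)
  then show ?thesis
  proof cases
    case 1
    have "r ^ 3 - r + 2 * r - (r + i) * r\<^sup>2 = 0"
      using i(2) by algebra
    then show ?thesis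
      using 1 by (simp add: kernel_Suc_Suc i(1)) (simp add: kernel_def)
  next
    case 2
    have "r * (r ^ 3 - r) + r\<^sup>2 - (r + i) * (r ^ 3 - r) = 1"
      using i(2) by algebra
    then show ?thesis
      using 2 by (simp add: kernel_Suc_Suc i(1)) (simp add: kernel_def)
  next
    case (3 m)
    have "r * (r * p) * (r ^ 3 - r) + p * (r ^ 3 - r) - (r + i) * (r * p * (r ^ 3 - r)) = 0" for p
      using i(2) by algebra
    then show ?thesis
      unfolding 3 kernel_Suc_Suc i(1) power_Suc by simp
  qed
qed

text \<open>The right-hand side is the second difference with step 2 of a unit mass at 0; pairing
  \<open>u\<close> with it yields the second difference of \<open>u\<close>. Away from 0 the
  evenness in \<open>k\<close> reduces to natural indices.\<close>

lemma kernel_recurrence: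
  fixes k :: int
  assumes "r \<noteq> 0"
  shows "kernel r (nat \<bar>k + 1\<bar>) + kernel r (nat \<bar>k - 1\<bar>) - (r + inverse r) * kernel r (nat \<bar>k\<bar>)
    = (if \<bar>k\<bar> = 2 then 1 else if k = 0 then - 2 else 0)"
proof (cases "k = 0")
  case True
  then show ?thesis
    using assms by (simp add: kernel_def field_simps power2_eq_square)
next
  case False
  define m where "m = nat (\<bar>k\<bar> - 1)"
  have nk: "nat \<bar>k\<bar> = Suc m"
    using False by (auto simp: m_def)
  have "(nat \<bar>k + 1\<bar> = m \<and> nat \<bar>k - 1\<bar> = Suc (Suc m)) \<or> (nat \<bar>k + 1\<bar> = Suc (Suc m) \<and> nat \<bar>k - 1\<bar> = m)"
    using False by (auto simp: m_def)
  then have "kernel r (nat \<bar>k + 1\<bar>) + kernel r (nat \<bar>k - 1\<bar>) = kernel r (Suc (Suc m)) + kernel r m"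
    by (elim disjE conjE) (simp_all only: add.commute)
  moreover have "m = 1 \<longleftrightarrow> \<bar>k\<bar> = 2"
    using False by (auto simp: m_def)
  ultimately show ?thesis
    using kernel_recurrence_nat[OF assms, of m] False unfolding nk by simp
qed

lemma norm_kernel_le:
  assumes "cmod r \<le> 1"
  shows "cmod (kernel r k) \<le> 2"
proof -
  have p: "cmod (r ^ m) \<le> 1" for m
    using assms by (simp add: norm_power power_le_one)
  have "cmod (r ^ (k + 1) - r ^ (k - 1)) \<le> 2"
    using norm_triangle_ineq4[of "r ^ (k + 1)" "r ^ (k - 1)"] p[of "k + 1"] p[of "k - 1"] by linarith
  then show ?thesis
    using p[of 1] p[of 2] by (auto simp: kernel_def norm_mult)
qed

text \<open>Beyond the source the kernel carries exactly the factor \<open>r - inverse r\<close>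
  with which \<open>laurent_vanishes\<close> annihilates the Laurent polynomial.\<close>

lemma kernel_eq_power_int:
  assumes "r \<noteq> 0" "\<bar>k\<bar> \<ge> 2"
  shows "kernel r (nat \<bar>k\<bar>) = (r - inverse r) * r powi \<bar>k\<bar>"
proof -
  obtain m where m: "\<bar>k\<bar> = int (Suc (Suc m))"
    using assms(2) by (intro that[of "nat (\<bar>k\<bar> - 2)"]) simp
  show ?thesis
    unfolding m nat_int kernel_Suc_Suc power_int_of_nat power_Suc using assms(1)
    by (simp add: power3_eq_cube left_diff_distrib) (simp add: algebra_simps)
qed

text \<open>Green's identity is applied to the kernel centred at \<open>m\<close>. By
  \<open>far\<close>, all of \<open>A\<close> lies on one side of \<open>m\<close> in direction
  \<open>i\<close> and beyond the source, so the pairing with \<open>f\<close> reduces to values of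
  \<open>F\<close> at a single root.\<close>

lemma second_difference_eq_0:
  fixes u :: "int ^ 'd \<Rightarrow> complex"
  assumes u: "((\<lambda>R. ball_energy u R / R) \<longlongrightarrow> 0) at_top"
    and A: "finite A" "\<And>n. n \<notin> A \<Longrightarrow> lattice_op (of_real \<mu>) u n = 0"
    and \<mu>: "\<bar>\<mu>\<bar> < 2 * real CARD('d)"
    and far: "\<And>n. n \<in> A \<Longrightarrow> \<bar>n $ i\<bar> + 2 \<le> \<bar>m $ i\<bar>"
  shows "u (m + axis i 2) + u (m - axis i 2) = 2 * u m"
proof -
  define f where "f = lattice_op (of_real \<mu>) u"
  define r where "r x = small_root (symbol \<mu> i x)" for x
  \<comment> \<open>The factor \<open>wave i (- m) x\<close> centres the kernel at \<open>m\<close>: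
    by orthogonality the source lives on the line through \<open>m\<close> in direction
    \<open>i\<close>.\<close>
  define b where "b k x = wave i (- m) x * kernel (r x) (nat \<bar>k - m $ i\<bar>)" for k x
  define c :: "int \<Rightarrow> complex" where "c k = (if \<bar>k\<bar> = 2 then 1 else if k = 0 then - 2 else 0)" for k
  define B where "B = {m + axis i 2, m - axis i 2, m}"
  have [simp]: "r x \<noteq> 0" for x
    by (simp add: r_def)
  have [measurable]: "b k \<in> borel_measurable torus" for k
    unfolding b_def kernel_def r_def by measurable
  have b_le: "cmod (b k x) \<le> 2" for k x
    by (simp add: b_def norm_mult r_def norm_kernel_le norm_small_root_le_1)
  have "(\<lambda>n. lattice_op (of_real \<mu>) (synthesis i b) n) = (\<lambda>n. if \<forall>j. j \<noteq> i \<longrightarrow> n $ j = m $ j then c (n $ i - m $ i) else 0)"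
  proof
    fix n
    have rec: "b (n $ i + 1) x + b (n $ i - 1) x - symbol \<mu> i x * b (n $ i) x = wave i (- m) x * c (n $ i - m $ i)" for x
    proof -
      have "complex_of_real (symbol \<mu> i x) = r x + inverse (r x)"
        by (simp add: r_def small_root_add_inverse)
      then show ?thesis
        using kernel_recurrence[of "r x" "n $ i - m $ i"]
        by (simp add: b_def c_def algebra_simps flip: distrib_left)
    qed
    have "lattice_op (of_real \<mu>) (synthesis i b) n = (\<integral>x. wave i n x * (wave i (- m) x * c (n $ i - m $ i)) \<partial>torus)"
      by (subst lattice_op_synthesis[where K = 2]) (auto simp: b_le rec)
    also have "\<dots> = (\<integral>x. wave i (n + - m) x * c (n $ i - m $ i) \<partial>torus)"
      by (simp only: wave_add mult.assoc)
    also have "\<dots> = (if \<forall>j. j \<noteq> i \<longrightarrow> n $ j = m $ j then c (n $ i - m $ i) else 0)"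
      by (auto simp: integral_wave)
    finally show "lattice_op (of_real \<mu>) (synthesis i b) n = (if \<forall>j. j \<noteq> i \<longrightarrow> n $ j = m $ j then c (n $ i - m $ i) else 0)" .
  qed
  note op = fun_cong[OF this]
  have op_0: "lattice_op (of_real \<mu>) (synthesis i b) n = 0" if "n \<notin> B" for n
  proof (rule ccontr)
    assume "lattice_op (of_real \<mu>) (synthesis i b) n \<noteq> 0"
    then have *: "\<forall>j. j \<noteq> i \<longrightarrow> n $ j = m $ j" "n $ i - m $ i \<in> {0, 2, -2}"
      unfolding op by (auto simp: c_def split: if_splits)
    then have "n = m + axis i (n $ i - m $ i)"
      by (auto simp: vec_eq_iff axis_def)
    moreover have "m + axis i (- 2) = m - axis i 2" "m + axis i 0 = m"
      by (auto simp: vec_eq_iff axis_def)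
    ultimately have "n \<in> B"
      using *(2) unfolding B_def by (metis insert_iff singletonD)
    then show False
      using that by contradiction
  qed
  have "(\<Sum>n\<in>A. f n * synthesis i b n) = (\<Sum>n\<in>B. u n * lattice_op (of_real \<mu>) (synthesis i b) n)"
    unfolding f_def
  proof (rule green_identity[OF u _ A])
    show "ball_energy (synthesis i b) R \<le> 3 * 2\<^sup>2 * R" if "R \<ge> 1" for R
      by (rule synthesis_energy) (use b_le that in auto)
    show "lattice_op (of_real \<mu>) (synthesis i b) n = 0" if "n \<notin> B" for n
      using that by (rule op_0)
  qed (auto simp: B_def)
  also have "(\<Sum>n\<in>A. f n * synthesis i b n) = (\<integral>x. (\<Sum>n\<in>A. f n * (wave i n x * b (n $ i) x)) \<partial>torus)"
    unfolding synthesis_def integral_mult_right_zero[symmetric]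
    by (rule Bochner_Integration.integral_sum[symmetric], intro integrable_mult_right torus_integrable[where K = 2])
       (auto simp: norm_mult b_le)
  also have "\<dots> = (\<integral>x. 0 \<partial>(torus :: ('d \<Rightarrow> real) measure))"
  proof (intro Bochner_Integration.integral_cong refl)
    fix x :: "'d \<Rightarrow> real"
    have F: "(r x - inverse (r x)) * laurent f A i x (r x) = 0" "(r x - inverse (r x)) * laurent f A i x (inverse (r x)) = 0"
      using laurent_vanishes[OF u A \<mu>, of "r x" i x] laurent_vanishes[OF u A \<mu>, of "inverse (r x)" i x]
      by (auto simp: r_def small_root_add_inverse add.commute f_def)
    have b: "b (n $ i) x = wave i (- m) x * ((r x - inverse (r x)) * r x powi \<bar>n $ i - m $ i\<bar>)" if "n \<in> A" for n
      unfolding b_def using far[OF that] by (subst kernel_eq_power_int) auto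
    \<comment> \<open>The sign of \<open>m $ i\<close> decides on which side of \<open>A\<close> the
      point \<open>m\<close> lies, and so whether powers of \<open>inverse (r x)\<close> or of
      \<open>r x\<close> appear.\<close>
    show "(\<Sum>n\<in>A. f n * (wave i n x * b (n $ i) x)) = 0"
    proof (cases "m $ i \<ge> 0")
      case True
      have "r x powi \<bar>n $ i - m $ i\<bar> = r x powi (m $ i) * inverse (r x) powi (n $ i)" if "n \<in> A" for n
      proof -
        have "\<bar>n $ i - m $ i\<bar> = m $ i - n $ i"
          using True far[OF that] by linarith
        then show ?thesis
          by (simp add: power_int_diff power_int_inverse divide_inverse)
      qed
      then have "(\<Sum>n\<in>A. f n * (wave i n x * b (n $ i) x))
          = wave i (- m) x * r x powi (m $ i) * ((r x - inverse (r x)) * laurent f A i x (inverse (r x)))"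
        unfolding laurent_def sum_distrib_left by (intro sum.cong refl) (simp only: b mult_ac)
      then show ?thesis
        by (simp only: F mult_zero_right)
    next
      case False
      have "r x powi \<bar>n $ i - m $ i\<bar> = r x powi (- (m $ i)) * r x powi (n $ i)" if "n \<in> A" for n
      proof -
        have "\<bar>n $ i - m $ i\<bar> = - (m $ i) + n $ i"
          using False far[OF that] by linarith
        then show ?thesis
          by (simp only: power_int_add \<open>r x \<noteq> 0\<close> simp_thms)
      qed
      then have "(\<Sum>n\<in>A. f n * (wave i n x * b (n $ i) x))
          = wave i (- m) x * r x powi (- (m $ i)) * ((r x - inverse (r x)) * laurent f A i x (r x))"
        unfolding laurent_def sum_distrib_left by (intro sum.cong refl) (simp only: b mult_ac)
      then show ?thesis
        by (simp only: F mult_zero_right)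
    qed
  qed
  finally have "(\<Sum>n\<in>B. u n * lattice_op (of_real \<mu>) (synthesis i b) n) = 0"
    by simp
  moreover have "m + axis i 2 \<noteq> m - axis i 2" "m + axis i 2 \<noteq> m" "m - axis i 2 \<noteq> m"
    by (auto simp: vec_eq_iff axis_def)
  moreover have "(\<forall>j. j \<noteq> i \<longrightarrow> (m + axis i 2) $ j = m $ j)" "(\<forall>j. j \<noteq> i \<longrightarrow> (m - axis i 2) $ j = m $ j)"
    by (auto simp: axis_def)
  ultimately show ?thesis
    unfolding op by (simp add: B_def c_def axis_def add_eq_0_iff algebra_simps)
qed

text \<open>The increment is a constant \<open>\<delta>\<close>, and its squared modulus is bounded
  by averages of \<open>2 * (cmod (a (j + 1)))\<^sup>2 + 2 * (cmod (a j))\<^sup>2\<close>, which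
  tend to 0. So \<open>a\<close> is constant, and its averages force that constant to be 0.\<close>

lemma affine_sequence_eq_0:
  fixes a :: "nat \<Rightarrow> complex"
  assumes rec: "\<And>j. a (j + 2) + a j = 2 * a (j + 1)"
    and lim: "(\<lambda>J. (\<Sum>j<J. (cmod (a j))\<^sup>2) / real J) \<longlonglongrightarrow> 0"
  shows "a 0 = 0"
proof -
  define S where "S J = (\<Sum>j<J. (cmod (a j))\<^sup>2)" for J
  define \<delta> where "\<delta> = a 1 - a 0"
  have diff: "a (Suc j) - a j = \<delta>" for j
  proof (induction j)
    case (Suc j)
    have "a (Suc (Suc j)) - a (Suc j) = a (Suc j) - a j"
      using rec[of j] by (simp add: algebra_simps)
    then show ?case
      using Suc by simp
  qed (simp add: \<delta>_def)
  have "(cmod \<delta>)\<^sup>2 \<le> 4 * (S (Suc J) / real (Suc J)) * (real (Suc J) / real J)" if "J \<ge> 1" for J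
  proof -
    have "(cmod \<delta>)\<^sup>2 \<le> 2 * (cmod (a (Suc j)))\<^sup>2 + 2 * (cmod (a j))\<^sup>2" for j
    proof -
      have "(cmod (a (Suc j) - a j))\<^sup>2 \<le> (cmod (a (Suc j)) + cmod (a j))\<^sup>2"
        by (intro power_mono norm_triangle_ineq4) auto
      also have "\<dots> \<le> 2 * (cmod (a (Suc j)))\<^sup>2 + 2 * (cmod (a j))\<^sup>2"
        using sum_squares_bound[of "cmod (a (Suc j))" "cmod (a j)"] by (simp add: power2_sum)
      finally show ?thesis
        by (simp only: diff)
    qed
    then have "(\<Sum>j<J. (cmod \<delta>)\<^sup>2) \<le> (\<Sum>j<J. 2 * (cmod (a (Suc j)))\<^sup>2 + 2 * (cmod (a j))\<^sup>2)"
      by (rule sum_mono)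
    also have "\<dots> = 2 * (\<Sum>j<J. (cmod (a (Suc j)))\<^sup>2) + 2 * S J"
      by (simp add: S_def sum.distrib sum_distrib_left)
    also have "(\<Sum>j<J. (cmod (a (Suc j)))\<^sup>2) \<le> S (Suc J)"
      unfolding S_def by (subst sum.lessThan_Suc_shift) simp
    also have "S J \<le> S (Suc J)"
      by (simp add: S_def)
    finally have "real J * (cmod \<delta>)\<^sup>2 \<le> 4 * S (Suc J)"
      by simp
    then have "(cmod \<delta>)\<^sup>2 \<le> 4 * S (Suc J) / real J"
      using that by (simp add: pos_le_divide_eq mult.commute)
    then show ?thesis
      by (simp del: of_nat_Suc)
  qed
  then have "\<exists>N. \<forall>J\<ge>N. (cmod \<delta>)\<^sup>2 \<le> 4 * (S (Suc J) / real (Suc J)) * (real (Suc J) / real J)"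
    by blast
  moreover have "(\<lambda>J. 4 * (S (Suc J) / real (Suc J)) * (real (Suc J) / real J)) \<longlonglongrightarrow> 4 * 0 * 1"
  proof (intro tendsto_mult tendsto_const)
    show "(\<lambda>J. S (Suc J) / real (Suc J)) \<longlonglongrightarrow> 0"
      using LIMSEQ_Suc[OF lim] unfolding S_def .
    show "(\<lambda>J. real (Suc J) / real J) \<longlonglongrightarrow> 1"
      by real_asymp
  qed
  ultimately have "(cmod \<delta>)\<^sup>2 \<le> 4 * 0 * 1"
    by (intro LIMSEQ_le_const)
  then have "\<delta> = 0"
    by simp
  obtain c where c: "a 0 = c"
    by blast
  have const: "a j = c" for j
  proof (induction j)
    case (Suc j)
    then show ?case
      using diff[of j] \<open>\<delta> = 0\<close> by simp
  qed (rule c)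
  have "\<forall>\<^sub>F J in sequentially. (\<Sum>j<J. (cmod (a j))\<^sup>2) / real J = (cmod c)\<^sup>2"
    using eventually_gt_at_top[of 0] by eventually_elim (simp add: const)
  then have "(\<lambda>J. (\<Sum>j<J. (cmod (a j))\<^sup>2) / real J) \<longlonglongrightarrow> (cmod c)\<^sup>2"
    by (rule tendsto_eventually)
  then have "(cmod c)\<^sup>2 = 0"
    by (rule LIMSEQ_unique[OF _ lim])
  then show ?thesis
    using c by simp
qed

text \<open>Moving outward from \<open>n\<close> in steps of 2 stays in the region where
  \<open>diff\<close> applies, so \<open>u\<close> is affine along this ray. The first
  \<open>J\<close> points lie in a ball of radius comparable to \<open>J\<close>, which transfers
  the decay of the energy.\<close>

lemma vanishes_along_axis:
  fixes u :: "int ^ 'd \<Rightarrow> complex"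
  assumes u: "((\<lambda>R. ball_energy u R / R) \<longlongrightarrow> 0) at_top"
    and diff: "\<And>m. \<bar>m $ i\<bar> \<ge> N \<Longrightarrow> u (m + axis i 2) + u (m - axis i 2) = 2 * u m"
    and n: "\<bar>n $ i\<bar> \<ge> N"
  shows "u n = 0"
proof -
  \<comment> \<open>The sign is chosen so that \<open>\<bar>p j $ i\<bar>\<close> grows with
    \<open>j\<close>.\<close>
  define s :: int where "s = (if n $ i \<ge> 0 then 1 else - 1)"
  define p where "p j = n + axis i (2 * s * int j)" for j
  have "u (p 0) = 0"
  proof (rule affine_sequence_eq_0[of "\<lambda>j. u (p j)"])
    fix j
    have far: "\<bar>p (j + 1) $ i\<bar> \<ge> N"
      using n by (auto simp: p_def s_def axis_def)
    show "u (p (j + 2)) + u (p j) = 2 * u (p (j + 1))"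
    proof (cases "n $ i \<ge> 0")
      case True
      then have "p (j + 2) = p (j + 1) + axis i 2" "p j = p (j + 1) - axis i 2"
        by (auto simp: p_def s_def vec_eq_iff axis_def)
      with diff[OF far] show ?thesis
        by simp
    next
      case False
      then have "p (j + 2) = p (j + 1) - axis i 2" "p j = p (j + 1) + axis i 2"
        by (auto simp: p_def s_def vec_eq_iff axis_def)
      with diff[OF far] show ?thesis
        by (simp add: add.commute)
    qed
  next
    define R where "R J = lattice_norm n + 2 * real J" for J
    have "inj p"
      by (auto simp: inj_def p_def vec_eq_iff axis_def s_def split: if_splits)
    have bound: "(\<Sum>j<J. (cmod (u (p j)))\<^sup>2) \<le> ball_energy u (R J)" for J
    proof -
      have "(\<Sum>j<J. (cmod (u (p j)))\<^sup>2) = (\<Sum>m\<in>p ` {..<J}. (cmod (u m))\<^sup>2)"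
        using \<open>inj p\<close> by (subst sum.reindex) (auto intro: inj_on_subset)
      also have "\<dots> \<le> ball_energy u (R J)"
        unfolding ball_energy_def
      proof (intro sum_mono2 finite_lattice_ball image_subsetI CollectI)
        fix j assume "j \<in> {..<J}"
        then show "lattice_norm (p j) < R J"
          using lattice_norm_add[of n "axis i (2 * s * int j)"] by (auto simp: p_def s_def R_def)
      qed auto
      finally show ?thesis .
    qed
    have "filterlim R at_top sequentially"
      unfolding R_def by real_asymp
    then have "(\<lambda>J. ball_energy u (R J) / R J) \<longlonglongrightarrow> 0"
      by (rule filterlim_compose[OF u])
    moreover have "(\<lambda>J. R J / real J) \<longlonglongrightarrow> 2"
      unfolding R_def by real_asymp
    ultimately have "(\<lambda>J. (ball_energy u (R J) / R J) * (R J / real J)) \<longlonglongrightarrow> 0 * 2"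
      by (rule tendsto_mult)
    then have "(\<lambda>J. (ball_energy u (R J) / R J) * (R J / real J)) \<longlonglongrightarrow> 0"
      by simp
    then show "(\<lambda>J. (\<Sum>j<J. (cmod (u (p j)))\<^sup>2) / real J) \<longlonglongrightarrow> 0"
    proof (rule Lim_null_comparison[rotated])
      show "\<forall>\<^sub>F J in sequentially. norm ((\<Sum>j<J. (cmod (u (p j)))\<^sup>2) / real J) \<le> (ball_energy u (R J) / R J) * (R J / real J)"
        using eventually_gt_at_top[of 0]
      proof eventually_elim
        case (elim J)
        then have "R J > 0"
          using lattice_norm_nonneg[of n] by (simp add: R_def)
        then show ?case
          using bound[of J] by (simp add: sum_nonneg divide_right_mono)
      qed
    qed
  qed
  moreover have "p 0 = n"
    by (simp add: p_def vec_eq_iff axis_def)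
  ultimately show ?thesis
    by simp
qed

section \<open>Reduction of the eigenvalue problem and assembly of the bounds\<close>

theorem theorem1p1:
  fixes u :: "int ^ 'd \<Rightarrow> complex" and lam R0 :: real
  assumes "CARD('d) \<ge> 2"
    and "0 < lam" and "lam < real CARD('d)"
    and "R0 > 0"
    and "\<And>n. lattice_norm n > R0 \<Longrightarrow> - disc_laplacian u n - complex_of_real lam * u n = 0"
    and "((\<lambda>R. 1 / R * (\<Sum>n | R0 < lattice_norm n \<and> lattice_norm n < R. (cmod (u n))\<^sup>2))
            \<longlongrightarrow> 0) at_top"
  shows "\<exists>R1>R0. \<forall>n. lattice_norm n > R1 \<longrightarrow> u n = 0"
proof -
  \<comment> \<open>Multiplying the equation by -4 gives \<open>lattice_op\<close> with this
    \<open>\<mu>\<close>; \<open>lam\<close> strictly between 0 and d becomes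
    \<open>\<bar>\<mu>\<bar>\<close> below 2 d.\<close>
  define \<mu> where "\<mu> = 2 * real CARD('d) - 4 * lam"
  define A where "A = {n :: int ^ 'd. lattice_norm n < R0 + 1}"
  \<comment> \<open>Coordinates of points of \<open>A\<close> are at most
    \<open>\<lceil>R0\<rceil> + 1\<close> in modulus, and the kernel needs a margin of 2.\<close>
  define N where "N = \<lceil>R0\<rceil> + 3"
  have "finite A"
    unfolding A_def by (rule finite_lattice_ball)
  moreover have "lattice_op (of_real \<mu>) u n = 0" if "n \<notin> A" for n
  proof -
    have "lattice_op (of_real \<mu>) u n = - 4 * (- disc_laplacian u n - complex_of_real lam * u n)"
      by (simp add: lattice_op_def disc_laplacian_def \<mu>_def algebra_simps)
    also have "- disc_laplacian u n - complex_of_real lam * u n = 0"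
      by (rule assms(5)) (use that in \<open>simp add: A_def\<close>)
    finally show ?thesis
      by simp
  qed
  ultimately have A: "finite A" "\<And>n. n \<notin> A \<Longrightarrow> lattice_op (of_real \<mu>) u n = 0"
    by blast+
  have \<mu>: "\<bar>\<mu>\<bar> < 2 * real CARD('d)"
    using assms(2,3) by (simp add: \<mu>_def abs_less_iff)
  \<comment> \<open>A fixed bound for the energy near the origin, which the decay hypothesis leaves
    out.\<close>
  define C where "C = (\<Sum>n\<in>A. (cmod (u n))\<^sup>2)"
  define T where "T R = (\<Sum>n | R0 < lattice_norm n \<and> lattice_norm n < R. (cmod (u n))\<^sup>2)" for R
  have u: "((\<lambda>R. ball_energy u R / R) \<longlongrightarrow> 0) at_top"
  proof (rule Lim_null_comparison)
    have "((\<lambda>R. C / R) \<longlongrightarrow> 0) at_top"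
      by real_asymp
    then show "((\<lambda>R. C / R + 1 / R * T R) \<longlongrightarrow> 0) at_top"
      using tendsto_add[OF _ assms(6)] unfolding T_def by fastforce
    show "\<forall>\<^sub>F R in at_top. norm (ball_energy u R / R) \<le> C / R + 1 / R * T R"
      using eventually_gt_at_top[of 0]
    proof eventually_elim
      case (elim R)
      let ?T = "{n :: int ^ 'd. R0 < lattice_norm n \<and> lattice_norm n < R}"
      have fin: "finite ?T"
        by (rule finite_subset[OF _ finite_lattice_ball[of R]]) auto
      have "ball_energy u R \<le> (\<Sum>n\<in>A \<union> ?T. (cmod (u n))\<^sup>2)"
        unfolding ball_energy_def using fin A(1) by (intro sum_mono2) (auto simp: A_def)
      also have "\<dots> \<le> C + T R"
        unfolding C_def T_def using fin A(1) by (simp add: sum_Un sum_nonneg)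
      finally have "ball_energy u R / R \<le> (C + T R) / R"
        using elim by (simp add: divide_right_mono)
      moreover have "ball_energy u R \<ge> 0"
        by (simp add: ball_energy_def sum_nonneg)
      ultimately show ?case
        using elim by (simp add: add_divide_distrib)
    qed
  qed
  have far: "u n = 0" if "\<bar>n $ i\<bar> \<ge> N" for n i
  proof (rule vanishes_along_axis[OF u _ that])
    fix m :: "int ^ 'd" assume m: "\<bar>m $ i\<bar> \<ge> N"
    show "u (m + axis i 2) + u (m - axis i 2) = 2 * u m"
    proof (rule second_difference_eq_0[OF u A \<mu>])
      fix n assume "n \<in> A"
      then have "real_of_int \<bar>n $ i\<bar> < R0 + 1"
        using abs_nth_le_lattice_norm[of n i] by (simp add: A_def)
      then have "\<bar>n $ i\<bar> \<le> \<lceil>R0\<rceil> + 1"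
        by linarith
      then show "\<bar>n $ i\<bar> + 2 \<le> \<bar>m $ i\<bar>"
        using m by (simp add: N_def)
    qed
  qed
  show ?thesis
  \<comment> \<open>If all coordinates are below \<open>N\<close> in modulus, the l1 norm, and so
    the Euclidean one, is at most d times \<open>N\<close>. Adding \<open>R0\<close> makes the
    radius exceed \<open>R0\<close>.\<close>
  proof (intro exI[of _ "R0 + real CARD('d) * real_of_int N"] conjI allI impI)
    have "N > 0"
      using assms(4) by (simp add: N_def) linarith
    then show "R0 + real CARD('d) * real_of_int N > R0"
      by simp
    fix n :: "int ^ 'd" assume n: "R0 + real CARD('d) * real_of_int N < lattice_norm n"
    have "\<exists>i. \<bar>n $ i\<bar> \<ge> N"
    proof (rule ccontr)
      assume "\<not> (\<exists>i. \<bar>n $ i\<bar> \<ge> N)"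
      then have "(\<Sum>i\<in>UNIV. \<bar>real_of_int (n $ i)\<bar>) \<le> (\<Sum>i\<in>(UNIV :: 'd set). real_of_int N)"
        by (intro sum_mono) (simp add: not_le less_imp_le flip: of_int_abs)
      then show False
        using n lattice_norm_le_sum[of n] assms(4) by simp
    qed
    then show "u n = 0"
      using far by blast
  qed
qed

end
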